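(* Assume that the Bateman--Horn conjecture holds. Let $k$ be a positive even integer. Then, as $x \to \infty$, $$\#\{p \in \Pi_k(x) : S(p)\,T(p) > 0\} \sim \pi_k(x).$$
   Context: $\varphi$ is Euler's totient function. For a positive even integer $k$, $\Pi_k$ is the set of primes $p$ such that $p+k$ is also prime, $\Pi_k(x) = \{p \in \Pi_k : p \le x\}$, and $\pi_k(x) = \#\Pi_k(x)$. For $p \in \Pi_k$ set $$T(p) = \varphi(p-1) - \varphi(p+k-1), \qquad S(p) = \frac{\varphi(p-1)}{p-1} - \frac{\varphi(p+k-1)}{p+k-1}.$$ Bateman--Horn conjecture: let $f_1,\dots,f_m$ be distinct irreducible polynomials with integer coefficients and positive leading coefficients such that $f = f_1\cdots f_m$ does not vanish identically modulo any prime. Let $P(x)$ be the number of positive integers $n \le x$ such that $f_1(n),\dots,f_m(n)$ are all prime. Then $P(x) \sim \frac{C}{D}\int_2^x \frac{dt}{(\log t)^m}$ as $x \to \infty$, where $D = \prod_{i=1}^m \deg f_i$, $C = \prod_p \frac{1 - N_f(p)/p}{(1-1/p)^m}$ (product over all primes $p$ in increasing order), and $N_f(p)$ is the number of solutions of $f(n) \equiv 0 \pmod p$ in residue classes modulo $p$. Assuming the conjecture means assuming it for all such collections. *)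

theory Defs
  imports
    "HOL-Analysis.Analysis"
    "HOL-Library.Landau_Symbols"
    "HOL-Computational_Algebra.Computational_Algebra"
    "HOL-Number_Theory.Number_Theory"
begin

text \<open>
  A collection \<open>f\<^sub>1, \<dots>, f\<^sub>m\<close> of distinct polynomials is a finite set \<open>F\<close> with \<open>m = card F\<close>.
  ``Vanishing identically modulo \<open>p\<close>'' refers to the values of the product at the integers,
  not to its coefficients.
\<close>

definition admissible :: "int poly set \<Rightarrow> bool" where
  "admissible F \<longleftrightarrow>
     finite F \<and> F \<noteq> {} \<and> (\<forall>f\<in>F. irreducible f \<and> lead_coeff f > 0) \<and>
     (\<forall>p::nat. prime p \<longrightarrow> \<not> (\<forall>n::int. [poly (\<Prod>f\<in>F. f) n = 0] (mod int p)))"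

definition prime_value_count :: "int poly set \<Rightarrow> real \<Rightarrow> nat" where
  "prime_value_count F x =
     card {n::nat. n > 0 \<and> real n \<le> x \<and> (\<forall>f\<in>F. prime (poly f (int n)))}"

definition num_roots_mod :: "int poly \<Rightarrow> nat \<Rightarrow> nat" where
  "num_roots_mod f p = card {n \<in> {0..<int p}. [poly f n = 0] (mod int p)}"

text \<open>
  The product over the primes is in general only conditionally convergent, so it is taken as the
  limit of the partial products over the primes up to \<open>N\<close>.
\<close>

definition bateman_horn_constant :: "int poly set \<Rightarrow> real" where
  "bateman_horn_constant F =
     lim (\<lambda>N::nat. \<Prod>p | prime p \<and> p \<le> N.
       (1 - real (num_roots_mod (\<Prod>f\<in>F. f) p) / real p) / (1 - 1 / real p) ^ card F)"

definition bateman_horn_conjecture :: bool where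
  "bateman_horn_conjecture \<longleftrightarrow>
     (\<forall>F. admissible F \<longrightarrow>
        (\<lambda>x. real (prime_value_count F x)) \<sim>[at_top]
        (\<lambda>x. bateman_horn_constant F / real (\<Prod>f\<in>F. degree f) *
               integral {2..x} (\<lambda>t. 1 / ln t ^ card F)))"

definition prime_pairs :: "nat \<Rightarrow> nat set" where
  "prime_pairs k = {p. prime p \<and> prime (p + k)}"

definition prime_pairs_upto :: "nat \<Rightarrow> real \<Rightarrow> nat set" where
  "prime_pairs_upto k x = {p \<in> prime_pairs k. real p \<le> x}"

definition prime_pairs_count :: "nat \<Rightarrow> real \<Rightarrow> nat" where
  "prime_pairs_count k x = card (prime_pairs_upto k x)"

definition totient_diff :: "nat \<Rightarrow> nat \<Rightarrow> real" where
  "totient_diff k p = real (totient (p - 1)) - real (totient (p + k - 1))"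

definition totient_ratio_diff :: "nat \<Rightarrow> nat \<Rightarrow> real" where
  "totient_ratio_diff k p =
     real (totient (p - 1)) / real (p - 1) - real (totient (p + k - 1)) / real (p + k - 1)"

end

theory Submission
  imports Defs "HOL-Real_Asymp.Real_Asymp"
begin

text \<open>
  Put \<open>n = p - 1\<close> and call \<open>p\<close> bad if the product in question is not positive. If
  \<open>totient n > totient (n + k)\<close>, both factors are positive. So a bad \<open>p\<close> satisfies either
  \<open>totient n = totient (n + k)\<close>, or \<open>totient n < totient (n + k)\<close> with a nonnegative difference of the
  ratios, and the latter squeezes \<open>totient (n + k) - totient n\<close> between 1 and \<open>k\<close>. If \<open>n\<close> and \<open>n + k\<close>
  both have at least \<open>k + 2\<close> prime factors, both totients are multiples of \<open>2 ^ (k + 1) > k\<close>, and the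
  latter case cannot occur (\<open>sign_product_pos_or_equal_totients\<close>). The theorem therefore follows from
  two facts.

  (1) Under the conjecture, for every \<open>\<epsilon> > 0\<close> all but a proportion \<open>\<epsilon>\<close> of the \<open>p\<close> are such that \<open>p - 1\<close> and \<open>p + k - 1\<close>
  have at least \<open>k + 2\<close> prime factors (\<open>prime_pairs_rarely_few_divisors\<close>). Indeed, the conjecture for
  the forms \<open>M * X + a\<close> and \<open>M * X + a + k\<close> says that the prime pairs are equidistributed among the
  admissible residue classes modulo any fixed odd \<open>M\<close>; so divisibility of \<open>p - 1\<close>, or \<open>p + k - 1\<close>, by
  the primes \<open>l\<close> of a fixed finite set behaves like independent events of probability at least \<open>1 / l\<close>,
  and the sum of \<open>1 / l\<close> over the primes diverges.

  (2) Unconditionally, only \<open>o(X / ln\<^sup>2 X)\<close> integers \<open>n \<le> X\<close> with at least \<open>k + 2\<close> prime factors satisfy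
  \<open>totient n = totient (n + k)\<close> (\<open>card_equal_totient_shift_smallo\<close>); by the conjecture this is
  negligible compared with the number of prime pairs. The argument is in the spirit of Erdos, Pomerance
  and Sarkozy. Apart from few exceptions, \<open>n\<close> has a large prime factor \<open>q\<close>, and \<open>q - 1\<close> divides
  \<open>totient (n + k)\<close>, a product of few factors; so \<open>n + k\<close> has a prime factor \<open>s\<close> for which
  \<open>gcd (q - 1) (s - 1)\<close> is large. If \<open>q * s\<close> is not much larger than \<open>X\<close>, count the multiples of \<open>q\<close> and
  \<open>s\<close>: correlated pairs \<open>(q, s)\<close> are rare. If \<open>q * s\<close> is larger, write \<open>n = m * q\<close> and
  \<open>n + k = m' * s\<close>. There are few pairs \<open>(m, m')\<close>, and each determines \<open>n\<close> through a linear system,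
  unless its determinant vanishes; this happens only if \<open>m' = m + k\<close> and \<open>m\<close> has no prime factor beyond
  \<open>k\<close>, which the number of prime factors of \<open>n\<close> rules out.
\<close>

section \<open>Counting by divisors and prime factors\<close>

lemma card_congruent_le:
  fixes A :: "nat set" and m X :: nat
  assumes "A \<subseteq> {..X}" "\<And>a b. a \<in> A \<Longrightarrow> b \<in> A \<Longrightarrow> a mod m = b mod m"
  shows "card A \<le> X div m + 1"
proof -
  have "inj_on (\<lambda>n. n div m) A"
    by (intro inj_onI) (metis assms(2) div_mult_mod_eq)
  moreover have "(\<lambda>n. n div m) ` A \<subseteq> {..X div m}"
    using assms(1) by (auto intro: div_le_mono)
  ultimately have "card A \<le> card {..X div m}"
    by (intro card_inj_on_le) auto
  thus ?thesis by simp
qed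

lemma card_multiples_le: "real (card {n \<in> {1..Z}. d dvd n}) \<le> real Z / real d"
proof (cases "d = 0")
  case False
  have "{n \<in> {1..Z}. d dvd n} \<subseteq> (\<lambda>j. d * j) ` {1..Z div d}"
  proof safe
    fix n assume n: "n \<in> {1..Z}" "d dvd n"
    then obtain j where j: "n = d * j" by auto
    have "j \<le> Z div d" using n j False
      by (metis atLeastAtMost_iff div_le_mono nonzero_mult_div_cancel_left)
    moreover have "j \<ge> 1" using n j by (cases j) auto
    ultimately show "n \<in> (\<lambda>j. d * j) ` {1..Z div d}" using j by auto
  qed
  hence "card {n \<in> {1..Z}. d dvd n} \<le> card ((\<lambda>j. d * j) ` {1..Z div d})"
    by (intro card_mono) auto
  also have "\<dots> \<le> Z div d" using card_image_le[of "{1..Z div d}"] by simp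
  finally have "real (card {n \<in> {1..Z}. d dvd n}) \<le> real (Z div d)" by simp
  also have "\<dots> \<le> real Z / real d" by (rule of_nat_div_le_of_nat)
  finally show ?thesis .
next
  case True
  have empty: "{n \<in> {1..Z}. d dvd n} = {}" using True by auto
  show ?thesis unfolding empty by simp
qed

lemma card_shift_le:
  fixes P :: "nat \<Rightarrow> bool"
  shows "card {n \<in> {1..X}. P (n + k)} \<le> card {n \<in> {1..X + k}. P n}"
  by (rule card_inj_on_le[where f = "\<lambda>n. n + k"]) (auto simp: inj_on_def)

lemma sum_inverse_le: "(\<Sum>m=1..Z. 1 / real m) \<le> 1 + ln (real Z)"
proof (induction Z)
  case (Suc Z)
  show ?case
  proof (cases "Z = 0")
    case False
    have "ln (real Z / real (Suc Z)) \<le> real Z / real (Suc Z) - 1"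
      using False by (intro ln_le_minus_one) auto
    also have "\<dots> = - 1 / real (Suc Z)" by (simp add: field_simps)
    finally have "1 / real (Suc Z) \<le> ln (real (Suc Z)) - ln (real Z)"
      using False by (simp add: ln_div)
    thus ?thesis using Suc by simp
  qed auto
qed auto

lemma sum_inverse_squares_le:
  assumes "T \<ge> 1"
  shows "(\<Sum>t=T..Z. 1 / real t ^ 2) \<le> 2 / real T"
proof (cases "T \<le> Z")
  case True
  have "(\<Sum>t=T..Z. 1 / real t ^ 2) \<le> 2 / real T - 1 / real Z"
    using True
  proof (induction Z rule: dec_induct)
    case base
    show ?case using assms by (simp add: field_simps power2_eq_square)
  next
    case (step n)
    have n: "real n > 0" using step assms by simp
    have "1 / real (Suc n) ^ 2 \<le> 1 / (real n * real (Suc n))"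
      using n by (intro divide_left_mono) (auto simp: power2_eq_square)
    also have "\<dots> = 1 / real n - 1 / real (Suc n)" using n by (simp add: field_simps)
    finally show ?case using step by simp
  qed
  also have "\<dots> \<le> 2 / real T" by simp
  finally show ?thesis .
qed auto

text \<open>
  Summing \<open>Z / t\<^sup>2\<close> over \<open>t \<ge> H\<close>. Below, this rules out large prime powers with
  exponent at least 2 in \<open>n\<close> and \<open>n + k\<close>.
\<close>

lemma card_divisible_by_large_square_le:
  fixes H :: real
  assumes "H > 0"
  shows "real (card {n \<in> {1..Z}. \<exists>t. real t \<ge> H \<and> t\<^sup>2 dvd n}) \<le> 2 * real Z / H"
proof -
  define T where "T = nat \<lceil>H\<rceil>"
  have T: "real T \<ge> H" "T \<ge> 1" using assms unfolding T_def by linarith+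
  have "{n \<in> {1..Z}. \<exists>t. real t \<ge> H \<and> t\<^sup>2 dvd n} \<subseteq> (\<Union>t\<in>{T..Z}. {n \<in> {1..Z}. t\<^sup>2 dvd n})"
  proof safe
    fix n t assume n: "n \<in> {1..Z}" "real t \<ge> H" "t\<^sup>2 dvd n"
    have "t \<ge> T" using n(2) unfolding T_def by linarith
    moreover have "t \<le> Z"
    proof -
      have "t \<le> t\<^sup>2" by (simp add: power2_eq_square)
      also have "\<dots> \<le> n" using n by (intro dvd_imp_le) auto
      finally show ?thesis using n by auto
    qed
    ultimately show "n \<in> (\<Union>t\<in>{T..Z}. {n \<in> {1..Z}. t\<^sup>2 dvd n})" using n by auto
  qed
  hence "card {n \<in> {1..Z}. \<exists>t. real t \<ge> H \<and> t\<^sup>2 dvd n} \<le> card (\<Union>t\<in>{T..Z}. {n \<in> {1..Z}. t\<^sup>2 dvd n})"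
    by (intro card_mono) auto
  also have "\<dots> \<le> (\<Sum>t\<in>{T..Z}. card {n \<in> {1..Z}. t\<^sup>2 dvd n})"
    by (intro card_UN_le) auto
  finally have "real (card {n \<in> {1..Z}. \<exists>t. real t \<ge> H \<and> t\<^sup>2 dvd n}) \<le>
      (\<Sum>t\<in>{T..Z}. real (card {n \<in> {1..Z}. t\<^sup>2 dvd n}))"
    by (simp flip: of_nat_sum)
  also have "\<dots> \<le> (\<Sum>t\<in>{T..Z}. real Z / real (t\<^sup>2))"
    by (intro sum_mono card_multiples_le)
  also have "\<dots> = real Z * (\<Sum>t=T..Z. 1 / real t ^ 2)"
    by (simp add: sum_distrib_left)
  also have "\<dots> \<le> real Z * (2 / real T)"
    by (intro mult_left_mono sum_inverse_squares_le T) auto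
  also have "\<dots> \<le> real Z * (2 / H)"
    using T assms by (intro mult_left_mono divide_left_mono) auto
  finally show ?thesis by (simp add: mult.commute)
qed

text \<open>
  The products over the subsets of the set of prime factors are distinct divisors.
\<close>

lemma two_power_omega_le_card_divisors:
  fixes n :: nat
  assumes "n > 0"
  shows "2 ^ card (prime_factors n) \<le> card {d. d dvd n}"
proof -
  have "card (Pow (prime_factors n)) \<le> card {d. d dvd n}"
  proof (rule card_inj_on_le[where f = "\<lambda>S. \<Prod>S"])
    have pf: "prime_factors (\<Prod>S) = S" if "S \<subseteq> prime_factors n" for S
    proof -
      have fin: "finite S" using that finite_subset by blast
      have single: "prime_factors x = {x}" if "x \<in> S" for x
        using that \<open>S \<subseteq> prime_factors n\<close> by (subst prime_factorization_prime) auto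
      have "0 \<notin> (\<lambda>x. x) ` S" using that by auto
      hence "prime_factors (\<Prod>S) = (\<Union>x\<in>S. prime_factors x)"
        using fin by (subst prime_factors_prod) auto
      also have "\<dots> = S" using single by simp
      finally show ?thesis .
    qed
    show "inj_on (\<lambda>S. \<Prod>S) (Pow (prime_factors n))"
      by (intro inj_onI) (metis PowD pf)
    show "(\<lambda>S. \<Prod>S) ` Pow (prime_factors n) \<subseteq> {d. d dvd n}"
    proof safe
      fix S assume S: "S \<subseteq> prime_factors n"
      have "\<Prod>S dvd \<Prod>(prime_factors n)"
        using S by (intro prod_dvd_prod_subset) auto
      also have "\<dots> dvd (\<Prod>p\<in>prime_factors n. p ^ multiplicity p n)"
        by (intro prod_dvd_prod dvd_power) (auto simp: prime_factors_multiplicity)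
      also have "\<dots> = n" using assms by (rule prime_factorization_nat[symmetric])
      finally show "\<Prod>S dvd n" .
    qed
    show "finite {d. d dvd n}" using assms by simp
  qed
  thus ?thesis by (simp add: card_Pow)
qed

text \<open>
  Weight \<open>n\<close> by \<open>2 ^ \<omega>(n) / 2 ^ W\<close>, where \<open>\<omega>(n)\<close> is the number of distinct prime factors, and bound
  \<open>2 ^ \<omega>(n)\<close> by the number of divisors, whose sum over \<open>n \<le> Z\<close> is at most \<open>\<Sum>\<^sub>d Z / d\<close>.
\<close>

lemma card_many_prime_factors_le:
  "real (card {n \<in> {1..Z}. W < card (prime_factors n)}) \<le> real Z * (1 + ln (real Z)) / 2 ^ W"
proof -
  let ?A = "{n \<in> {1..Z}. W < card (prime_factors n)}"
  have "2 ^ W * real (card ?A) = (\<Sum>n\<in>?A. 2 ^ W)" by simp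
  also have "\<dots> \<le> (\<Sum>n\<in>?A. real (card {d. d dvd n}))"
  proof (intro sum_mono)
    fix n assume n: "n \<in> ?A"
    have "(2::nat) ^ W \<le> 2 ^ card (prime_factors n)"
      using n by (intro power_increasing) auto
    also have "\<dots> \<le> card {d. d dvd n}" using n by (intro two_power_omega_le_card_divisors) auto
    finally have "real (2 ^ W) \<le> real (card {d. d dvd n})" by (simp only: of_nat_le_iff)
    thus "2 ^ W \<le> real (card {d. d dvd n})" by simp
  qed
  also have "\<dots> \<le> (\<Sum>n=1..Z. real (card {d. d dvd n}))"
    by (intro sum_mono2) auto
  also have "\<dots> = (\<Sum>n=1..Z. \<Sum>d=1..Z. if d dvd n then 1 else 0)"
  proof (intro sum.cong refl)
    fix n assume n: "n \<in> {1..Z}"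
    have "{d. d dvd n} = {d \<in> {1..Z}. d dvd n}"
      using n by (auto dest: dvd_imp_le intro: Nat.gr0I)
    thus "real (card {d. d dvd n}) = (\<Sum>d=1..Z. if d dvd n then 1 else 0)"
      by (simp flip: sum.inter_filter)
  qed
  also have "\<dots> = (\<Sum>d=1..Z. \<Sum>n=1..Z. if d dvd n then 1 else 0)"
    by (rule sum.swap)
  also have "\<dots> = (\<Sum>d=1..Z. real (card {n \<in> {1..Z}. d dvd n}))"
    by (simp add: sum.If_cases Int_def)
  also have "\<dots> \<le> (\<Sum>d=1..Z. real Z / real d)"
    by (intro sum_mono card_multiples_le)
  also have "\<dots> = real Z * (\<Sum>d=1..Z. 1 / real d)" by (simp add: sum_distrib_left)
  also have "\<dots> \<le> real Z * (1 + ln (real Z))"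
    by (intro mult_left_mono sum_inverse_le) auto
  finally show ?thesis by (simp add: field_simps)
qed

text \<open>
  Each odd prime factor \<open>p\<close> contributes the even number \<open>p - 1\<close>; the prime 2 may contribute nothing,
  which costs one factor.
\<close>

lemma two_power_dvd_totient:
  fixes n :: nat
  assumes "n > 0" "v < card (prime_factors n)"
  shows "2 ^ v dvd totient n"
proof -
  let ?S = "prime_factors n - {2}"
  have "card (prime_factors n) \<le> Suc (card ?S)"
    by (simp add: card_Diff_singleton_if, linarith)
  hence "(2::nat) ^ v dvd 2 ^ card ?S" using assms by (intro le_imp_power_dvd) auto
  also have "(2::nat) ^ card ?S = (\<Prod>p\<in>?S. 2)" by simp
  also have "\<dots> dvd (\<Prod>p\<in>?S. p ^ (multiplicity p n - 1) * (p - 1))"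
  proof (intro prod_dvd_prod dvd_mult)
    fix p assume p: "p \<in> ?S"
    hence "prime p" "p \<noteq> 2" by auto
    hence "odd p" using primes_dvd_imp_eq two_is_prime_nat by blast
    thus "2 dvd p - 1" by simp
  qed
  also have "\<dots> dvd (\<Prod>p\<in>prime_factors n. p ^ (multiplicity p n - 1) * (p - 1))"
    by (intro prod_dvd_prod_subset) auto
  also have "\<dots> = totient n" using assms by (simp add: totient_formula1)
  finally show ?thesis .
qed

lemma exists_large_prime_power_factor:
  fixes n :: nat and Q :: real
  assumes "Q \<ge> 1" "card (prime_factors n) \<le> W" "real n > Q ^ W"
  shows "\<exists>p\<in>prime_factors n. real (p ^ multiplicity p n) > Q"
proof (rule ccontr)
  assume *: "\<not> ?thesis"
  have "n > 0" using assms by (cases n) (auto simp: not_less)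
  have "real n = (\<Prod>p\<in>prime_factors n. real (p ^ multiplicity p n))"
    using prime_factorization_nat[OF \<open>n > 0\<close>] by (metis of_nat_prod)
  also have "\<dots> \<le> (\<Prod>p\<in>prime_factors n. Q)"
    using * by (intro prod_mono) (auto simp: not_less)
  also have "\<dots> \<le> Q ^ W" using assms by (simp add: power_increasing)
  finally show False using assms by simp
qed

lemma gcd_mult_le:
  fixes a b c :: nat
  assumes "c > 0"
  shows "gcd c (a * b) \<le> gcd c a * gcd c b"
proof -
  have "gcd c (a * b) dvd gcd (gcd c a * c) (gcd (c * b) (a * b))"
    by (intro gcd_greatest) (auto intro: dvd_trans[OF gcd_dvd1])
  also have "\<dots> = gcd c a * gcd c b"
    by (simp add: gcd_mult_distrib_nat mult.commute)
  finally have "gcd c (a * b) dvd gcd c a * gcd c b" .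
  thus ?thesis using assms by (intro dvd_imp_le) auto
qed

lemma gcd_prod_le:
  fixes f :: "'a \<Rightarrow> nat"
  assumes "c > 0" "finite S"
  shows "gcd c (\<Prod>i\<in>S. f i) \<le> (\<Prod>i\<in>S. gcd c (f i))"
  using assms(2)
proof (induction S rule: finite_induct)
  case (insert x S)
  have "gcd c (f x * (\<Prod>i\<in>S. f i)) \<le> gcd c (f x) * gcd c (\<Prod>i\<in>S. f i)"
    by (rule gcd_mult_le[OF assms(1)])
  also have "\<dots> \<le> gcd c (f x) * (\<Prod>i\<in>S. gcd c (f i))"
    using insert by simp
  finally show ?case using insert by simp
qed auto

section \<open>Solutions of \<open>\<phi>(n) = \<phi>(n + k)\<close>\<close>

text \<open>
  Since \<open>n\<close> is large and has few prime factors, one of its prime powers exceeds \<open>Q\<close>; having no large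
  square divisor, \<open>n\<close> contains it as a prime \<open>q\<close> to the first power. Then \<open>q - 1\<close> divides
  \<open>totient n = totient N\<close>. The latter is a product of at most \<open>W\<close> factors \<open>s ^ (e - 1) * (s - 1)\<close>, so
  one of these has a large common divisor with \<open>q - 1\<close>; as \<open>s ^ (e - 1)\<close> is small, for the same reason
  as before, it is \<open>s - 1\<close> that correlates with \<open>q - 1\<close>.
\<close>

lemma exists_prime_factors_with_large_gcd:
  fixes n N W :: nat and H D Q :: real
  assumes pos: "n > 0" "N > 0" and tot: "totient n = totient N"
    and W: "card (prime_factors n) \<le> W" "card (prime_factors N) \<le> W"
    and sq: "\<And>t. real t \<ge> H \<Longrightarrow> \<not> t\<^sup>2 dvd n" "\<And>t. real t \<ge> H \<Longrightarrow> \<not> t\<^sup>2 dvd N"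
    and H: "H \<ge> 1" "H\<^sup>2 \<le> D" and Q: "Q \<ge> H ^ 3" "Q \<ge> D ^ (2 * W) + 1" and n: "real n > Q ^ W"
  shows "\<exists>q s. prime q \<and> q dvd n \<and> \<not> q\<^sup>2 dvd n \<and> real q > Q \<and> prime s \<and> s dvd N \<and>
           real (gcd (q - 1) (s - 1)) \<ge> D"
proof -
  have "H ^ 3 \<ge> 1" using H by simp
  hence Q1: "Q \<ge> 1" using Q by linarith
  obtain q where q: "q \<in> prime_factors n" "real (q ^ multiplicity q n) > Q"
    using exists_large_prime_power_factor[OF Q1 W(1) n] by blast
  define a where "a = multiplicity q n"
  have pq: "prime q" "q dvd n" using q by auto
  have q0: "real q \<ge> 1" using prime_ge_1_nat[OF pq(1)] by simp
  have a1: "a < 2"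
  proof (rule ccontr)
    assume "\<not> a < 2"
    define t where "t = q ^ (a div 2)"
    \<comment> \<open>\<open>a \<le> 3 * (a div 2)\<close> for every \<open>a \<ge> 2\<close>; this is where the cube in \<open>Q \<ge> H ^ 3\<close> comes from.\<close>
    have "H ^ 3 < real q ^ a" using q Q by (simp add: a_def)
    also have "\<dots> \<le> real q ^ (3 * (a div 2))"
      using \<open>\<not> a < 2\<close> q0 by (intro power_increasing) auto
    also have "\<dots> = real t ^ 3" by (simp add: t_def mult.commute flip: power_mult)
    finally have "H < real t" by (rule power_less_imp_less_base) simp
    moreover have "t\<^sup>2 dvd n"
    proof -
      have "t\<^sup>2 = q ^ (2 * (a div 2))" by (simp add: t_def mult.commute flip: power_mult)
      also have "\<dots> dvd q ^ a" by (intro le_imp_power_dvd) simp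
      also have "\<dots> dvd n" unfolding a_def by (rule multiplicity_dvd)
      finally show ?thesis .
    qed
    ultimately show False using sq(1)[of t] by simp
  qed
  have nsq: "\<not> q\<^sup>2 dvd n"
    using a1 pos pq by (subst power_dvd_iff_le_multiplicity) (auto simp: a_def)
  have "a = 1" using a1 pq pos q by (auto simp: a_def prime_factors_multiplicity)
  hence qQ: "real q > Q" using q(2) by (simp add: a_def)
  have qgt: "q > 1" using pq prime_gt_1_nat by blast

  define c where "c = q - 1"
  have c: "c > 0" using qgt by (simp add: c_def)
  have "totient q dvd totient n" by (rule totient_dvd[OF pq(2)])
  hence cN: "c dvd totient N" using tot pq by (simp add: totient_prime c_def)
  have "\<exists>s\<in>prime_factors N. real (gcd c (s - 1)) \<ge> D"
  proof (rule ccontr)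
    assume neg: "\<not> ?thesis"
    have "c = gcd c (totient N)" using cN by (simp add: gcd_nat.absorb1)
    also have "totient N = (\<Prod>p\<in>prime_factors N. p ^ (multiplicity p N - 1) * (p - 1))"
      by (rule totient_formula1[OF pos(2)])
    also have "gcd c \<dots> \<le> (\<Prod>p\<in>prime_factors N. gcd c (p ^ (multiplicity p N - 1) * (p - 1)))"
      by (rule gcd_prod_le[OF c]) auto
    finally have "real c \<le> (\<Prod>p\<in>prime_factors N. real (gcd c (p ^ (multiplicity p N - 1) * (p - 1))))"
      by (simp only: of_nat_le_iff flip: of_nat_prod)
    also have "\<dots> \<le> (\<Prod>p\<in>prime_factors N. D\<^sup>2)"
    proof (intro prod_mono conjI)
      fix p assume p: "p \<in> prime_factors N"
      define e where "e = multiplicity p N"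
      define t where "t = p ^ (e div 2)"
      have p1: "real p \<ge> 1" using p prime_ge_1_nat[of p] by auto
      have "t\<^sup>2 dvd N"
      proof -
        have "t\<^sup>2 = p ^ (2 * (e div 2))" by (simp add: t_def mult.commute flip: power_mult)
        also have "\<dots> dvd p ^ e" by (intro le_imp_power_dvd) simp
        also have "\<dots> dvd N" unfolding e_def by (rule multiplicity_dvd)
        finally show ?thesis .
      qed
      hence tH: "real t < H" using sq(2)[of t] by (meson not_le)
      have "real p ^ (e - 1) \<le> real p ^ (2 * (e div 2))"
        using p1 by (intro power_increasing) auto
      also have "\<dots> = real t ^ 2" by (simp add: t_def mult.commute flip: power_mult)
      also have "\<dots> \<le> H ^ 2" using tH by (intro power_mono) auto
      finally have peD: "real p ^ (e - 1) \<le> D" using H by linarith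
      have "gcd c (p ^ (e - 1) * (p - 1)) \<le> gcd c (p ^ (e - 1)) * gcd c (p - 1)"
        by (rule gcd_mult_le[OF c])
      also have "\<dots> \<le> p ^ (e - 1) * gcd c (p - 1)"
        using p by (intro mult_right_mono gcd_le2_nat) auto
      finally have "real (gcd c (p ^ (e - 1) * (p - 1))) \<le> real p ^ (e - 1) * real (gcd c (p - 1))"
        by (metis of_nat_le_iff of_nat_mult of_nat_power)
      also have "\<dots> \<le> D * D"
        using neg p peD p1 by (intro mult_mono) (auto simp: not_le less_imp_le intro: order_trans[OF _ peD])
      finally show "real (gcd c (p ^ (multiplicity p N - 1) * (p - 1))) \<le> D\<^sup>2"
        by (simp add: e_def power2_eq_square)
    qed auto
    also have "\<dots> \<le> (D\<^sup>2) ^ W"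
    proof -
      have "1 \<le> H ^ 2" using H by simp
      hence "1 \<le> D" using H by linarith
      thus ?thesis using W by (simp add: power_increasing)
    qed
    also have "\<dots> = D ^ (2 * W)" by (simp add: power_mult)
    finally have "real c \<le> Q - 1" using Q by linarith
    moreover have "real c = real q - 1" using qgt by (simp add: c_def)
    ultimately show False using qQ by simp
  qed
  thus ?thesis using pq nsq qQ by (auto simp: c_def)
qed

lemma prime_not_dvd_totient:
  fixes P c :: nat
  assumes "prime P" "c > 0" "\<And>p. prime p \<Longrightarrow> p dvd c \<Longrightarrow> p < P"
  shows "\<not> P dvd totient c"
proof
  assume "P dvd totient c"
  hence "P dvd (\<Prod>p\<in>prime_factors c. p ^ (multiplicity p c - 1) * (p - 1))"
    using assms by (simp add: totient_formula1)
  then obtain p where p: "p \<in> prime_factors c" "P dvd p ^ (multiplicity p c - 1) * (p - 1)"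
    using assms(1) by (auto simp: prime_dvd_prod_iff)
  have pp: "prime p" "p < P" using p assms(3) by auto
  have "P dvd p \<or> P dvd p - 1"
    using p(2) assms(1) prime_dvd_mult_iff prime_dvd_power by blast
  thus False using pp prime_gt_1_nat[OF pp(1)] by (auto dest!: dvd_imp_le)
qed

text \<open>
  Compare the exponents of \<open>P\<close>: no \<open>p - 1\<close> with \<open>p \<le> P\<close> prime is divisible by \<open>P\<close>, hence passing from
  \<open>a\<close> to its totient loses exactly one factor \<open>P\<close>. So if \<open>P ^ e\<close> is the power of \<open>P\<close> in \<open>a\<close>, it
  divides the left-hand side but not the right-hand side.
\<close>

lemma totient_ratio_neq_if_largest_prime_differs:
  fixes a b P :: nat
  assumes "prime P" "a > 0" "P dvd a" "\<not> P dvd b"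
    and "\<And>p. prime p \<Longrightarrow> p dvd a \<Longrightarrow> p \<le> P"
  shows "a * totient b \<noteq> b * totient a"
proof
  assume eq: "a * totient b = b * totient a"
  define e where "e = multiplicity P a"
  obtain c where c: "a = P ^ e * c" "\<not> P dvd c"
    unfolding e_def by (metis multiplicity_decompose' not_prime_unit assms(1,2) gr_implies_not0)
  have e: "e > 0" using c assms(3) by (cases e) auto
  have "c > 0" using c assms(2) by (cases c) auto
  have lt: "p < P" if "prime p" "p dvd c" for p
    using assms(5)[OF that(1)] that c by (metis dvd_mult le_neq_implies_less)
  have "coprime (P ^ e) c" using c(2) assms(1) by (simp add: prime_imp_coprime)
  hence "totient a = totient (P ^ e) * totient c" using c(1) totient_mult_coprime by simp
  also have "totient (P ^ e) = P ^ (e - 1) * (P - 1)" using assms(1) e by (rule totient_prime_power)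
  finally have ta: "totient a = P ^ (e - 1) * ((P - 1) * totient c)" by simp
  have "P ^ e = P ^ (e - 1) * P" using e by (metis power_minus_mult)
  hence "P ^ (e - 1) * (P * (c * totient b)) = P ^ (e - 1) * (b * ((P - 1) * totient c))"
    using eq c(1) ta by (simp add: ac_simps)
  hence "P * (c * totient b) = b * ((P - 1) * totient c)"
    using assms(1) by (simp add: prime_gt_0_nat)
  hence "P dvd b * ((P - 1) * totient c)" by (metis dvd_triv_left)
  moreover have "\<not> P dvd P - 1"
    using prime_gt_1_nat[OF assms(1)] by (auto dest!: dvd_imp_le)
  moreover have "\<not> P dvd totient c"
    using assms(1) \<open>c > 0\<close> lt by (rule prime_not_dvd_totient)
  ultimately show False using assms(1,4) by (simp add: prime_dvd_mult_iff)
qed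

text \<open>
  Otherwise the largest prime factor of \<open>m * (m + k)\<close> exceeds \<open>k\<close>, so it divides only one of \<open>m\<close> and
  \<open>m + k\<close>, and the previous lemma applies.
\<close>

lemma smooth_if_totient_ratio_eq_shift:
  fixes m k p :: nat
  assumes "m > 0" "m * totient (m + k) = (m + k) * totient m" "k > 0" "prime p" "p dvd m"
  shows "p \<le> k"
proof (rule ccontr)
  assume "\<not> p \<le> k"
  define S where "S = prime_factors (m * (m + k))"
  define P where "P = Max S"
  have "p \<in> S" using assms by (auto simp: S_def in_prime_factors_iff)
  hence P: "P \<in> S" "p \<le> P" unfolding P_def by (auto intro!: Max_in Max_ge simp: S_def)
  have pP: "prime P" and dv: "P dvd m * (m + k)" using P by (auto simp: S_def in_prime_factors_iff)
  have mx: "r \<le> P" if "prime r" "r dvd m * (m + k)" for r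
    using that assms unfolding P_def by (intro Max_ge) (auto simp: S_def in_prime_factors_iff)
  have "\<not> P dvd k" using P \<open>\<not> p \<le> k\<close> assms by (auto dest: dvd_imp_le)
  hence nb: "\<not> (P dvd m \<and> P dvd m + k)" by (simp add: dvd_add_right_iff)
  show False
  proof (cases "P dvd m")
    case True
    show False
      using totient_ratio_neq_if_largest_prime_differs[OF pP assms(1) True, of "m + k"] nb True mx assms
      by (auto intro: dvd_mult2)
  next
    case False
    hence "P dvd m + k" using dv pP by (simp add: prime_dvd_mult_iff)
    show False
      using totient_ratio_neq_if_largest_prime_differs[OF pP _ \<open>P dvd m + k\<close> False] mx assms
      by (auto intro: dvd_mult)
  qed
qed

text \<open>
  For given cofactors \<open>m\<close> and \<open>m'\<close> the two equations are linear in \<open>(q, s)\<close>, and the first assumption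
  says that their determinant does not vanish.
\<close>

lemma prime_pair_unique:
  fixes m m' q q' s s' k :: nat
  assumes "m * totient m' \<noteq> m' * totient m" "q > 0" "q' > 0" "s > 0" "s' > 0"
    and "m * q + k = m' * s" "m * q' + k = m' * s'"
    and "totient m * (q - 1) = totient m' * (s - 1)" "totient m * (q' - 1) = totient m' * (s' - 1)"
  shows "q = q'"
proof -
  have "int m * int q + int k = int m' * int s" "int m * int q' + int k = int m' * int s'"
    using assms(6,7) by (metis of_nat_add of_nat_mult)+
  hence 1: "int m * (int q - int q') = int m' * (int s - int s')" by (simp add: algebra_simps)
  have "int (totient m) * int (q - 1) = int (totient m') * int (s - 1)"
    "int (totient m) * int (q' - 1) = int (totient m') * int (s' - 1)"
    using assms(8,9) by (metis of_nat_mult)+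
  hence 2: "int (totient m) * (int q - int q') = int (totient m') * (int s - int s')"
    using assms(2-5) by (simp add: of_nat_diff Suc_leI algebra_simps)
  have "(int m * int (totient m')) * (int q - int q') = int (totient m') * (int m' * (int s - int s'))"
    using 1 by (simp add: ac_simps)
  also have "\<dots> = (int m' * int (totient m)) * (int q - int q')"
    using 2 by (simp add: ac_simps)
  finally have "int m * int (totient m') = int m' * int (totient m) \<or> int q = int q'" by auto
  thus ?thesis using assms(1) by (metis of_nat_eq_iff of_nat_mult)
qed

lemma card_pairs_le:
  fixes z :: real
  assumes "z \<ge> 0"
  shows "finite {(m, m'). m \<in> {1..X} \<and> m' > 0 \<and> real m * real m' \<le> z}" (is "finite ?P")
    and "real (card {(m, m'). m \<in> {1..X} \<and> m' > 0 \<and> real m * real m' \<le> z}) \<le> z * (1 + ln (real X))"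
proof -
  let ?S = "SIGMA m:{1..X}. {1..nat \<lfloor>z / real m\<rfloor>}"
  have sub: "?P \<subseteq> ?S"
  proof
    fix x assume "x \<in> ?P"
    then obtain m m' where m: "x = (m, m')" "m \<in> {1..X}" "m' > 0" "real m * real m' \<le> z" by blast
    hence "real m' \<le> z / real m" by (simp add: field_simps)
    hence "m' \<le> nat \<lfloor>z / real m\<rfloor>" by linarith
    thus "x \<in> ?S" using m by auto
  qed
  show "finite ?P" by (rule finite_subset[OF sub]) simp
  have "card ?P \<le> card ?S" by (rule card_mono[OF _ sub]) simp
  also have "\<dots> = (\<Sum>m=1..X. nat \<lfloor>z / real m\<rfloor>)" by simp
  finally have "real (card ?P) \<le> (\<Sum>m=1..X. real (nat \<lfloor>z / real m\<rfloor>))"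
    by (simp flip: of_nat_sum)
  also have "\<dots> \<le> (\<Sum>m=1..X. z / real m)"
    using assms by (intro sum_mono) (simp add: of_nat_nat)
  also have "\<dots> = z * (\<Sum>m=1..X. 1 / real m)" by (simp add: sum_distrib_left)
  also have "\<dots> \<le> z * (1 + ln (real X))"
    by (intro mult_left_mono sum_inverse_le assms)
  finally show "real (card ?P) \<le> z * (1 + ln (real X))" .
qed

text \<open>
  If the determinant \<open>m * totient m' - m' * totient m\<close> is nonzero, then \<open>(m, m')\<close> determines \<open>n\<close>, and the
  number of admissible pairs is at most \<open>\<Sum>\<^sub>m z / m\<close>. If it is zero, the two equations force
  \<open>m' = m + k\<close>, so all prime factors of \<open>m\<close> are at most \<open>k\<close>; then \<open>n = m * q\<close> has at most \<open>k + 1\<close>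
  prime factors. For even \<open>k\<close> this degenerate family contains genuine solutions (\<open>m = k\<close>,
  \<open>q = 2 * s - 1\<close>), and the hypothesis on the number of prime factors is there to exclude it.
\<close>

lemma card_determined_by_cofactors_le:
  fixes X k :: nat and z :: real
  assumes "k > 0" "z \<ge> 0"
  defines "A \<equiv> {n \<in> {1..X}. totient n = totient (n + k) \<and> k + 2 \<le> card (prime_factors n) \<and>
      (\<exists>m q m' s. n = m * q \<and> n + k = m' * s \<and> prime q \<and> prime s \<and> \<not> q dvd m \<and> \<not> s dvd m' \<and>
         real m * real m' \<le> z)}"
  shows "real (card A) \<le> z * (1 + ln (real X))"
proof -
  define R where "R = (\<lambda>n (m, m'). \<exists>q s. n = m * q \<and> n + k = m' * s \<and> prime q \<and> prime s \<and>
     \<not> q dvd m \<and> \<not> s dvd m' \<and> real m * real m' \<le> z)"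
  have "\<exists>mm. R n mm" if "n \<in> A" for n
  proof -
    have "\<exists>m q m' s. n = m * q \<and> n + k = m' * s \<and> prime q \<and> prime s \<and> \<not> q dvd m \<and> \<not> s dvd m' \<and>
        real m * real m' \<le> z" using that unfolding A_def by simp
    then obtain m q m' s where "n = m * q" "n + k = m' * s" "prime q" "prime s" "\<not> q dvd m" "\<not> s dvd m'"
      "real m * real m' \<le> z" by (elim exE conjE)
    hence "R n (m, m')" unfolding R_def prod.case by blast
    thus ?thesis ..
  qed
  then obtain f where f: "\<And>n. n \<in> A \<Longrightarrow> R n (f n)" by metis
  let ?P = "{(m, m'). m \<in> {1..X} \<and> m' > 0 \<and> real m * real m' \<le> z}"
  have eqs: "totient m * (q - 1) = totient m' * (s - 1)"
    if "n \<in> A" "n = m * q" "n + k = m' * s" "prime q" "prime s" "\<not> q dvd m" "\<not> s dvd m'" for n m q m' s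
  proof -
    have "coprime q m" "coprime s m'"
      using that by (auto intro: prime_imp_coprime)
    hence "coprime m q" "coprime m' s" by (simp_all add: coprime_commute)
    hence "totient n = totient m * (q - 1)" "totient (n + k) = totient m' * (s - 1)"
      using that by (simp_all add: totient_mult_coprime totient_prime)
    thus ?thesis using that(1) by (simp add: A_def)
  qed
  have nondeg: "m * totient m' \<noteq> m' * totient m"
    if A: "n \<in> A" and n: "n = m * q" "n + k = m' * s" and pr: "prime q" "prime s"
      and nd: "\<not> q dvd m" "\<not> s dvd m'" for n m q m' s
  proof
    assume deg: "m * totient m' = m' * totient m"
    have n0: "n > 0" using A by (simp add: A_def)
    have mpos: "m > 0" "m' > 0" using n n0 by (auto intro!: Nat.gr0I)
    have "totient m' * (m * (q - 1)) = m' * (totient m * (q - 1))" using deg by (simp add: ac_simps)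
    also have "\<dots> = totient m' * (m' * (s - 1))" using eqs[OF that] by (simp add: ac_simps)
    finally have "m * (q - 1) = m' * (s - 1)" using mpos by simp
    hence "m * q - m = m' * s - m'" by (simp add: diff_mult_distrib2)
    moreover have "m \<le> m * q" "m' \<le> m' * s" using prime_gt_0_nat[OF pr(1)] prime_gt_0_nat[OF pr(2)] by (simp_all add: Suc_le_eq)
    ultimately have m': "m' = m + k" using n by linarith
    have sm: "p \<le> k" if "prime p" "p dvd m" for p
      using smooth_if_totient_ratio_eq_shift[OF mpos(1) _ assms(1) that] deg m' by simp
    have "prime_factors n \<subseteq> insert q {1..k}"
    proof
      fix p assume "p \<in> prime_factors n"
      hence p: "prime p" "p dvd m * q" using n by auto
      hence "p dvd m \<or> p = q" using pr by (auto simp: prime_dvd_mult_iff primes_dvd_imp_eq)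
      thus "p \<in> insert q {1..k}" using sm p prime_ge_1_nat by auto
    qed
    hence "card (prime_factors n) \<le> card (insert q {1..k})" by (intro card_mono) auto
    also have "\<dots> \<le> k + 1" by (simp add: card_insert_if)
    finally show False using A by (simp add: A_def)
  qed
  have "inj_on f A"
  proof (rule inj_onI)
    fix n1 n2 assume n: "n1 \<in> A" "n2 \<in> A" "f n1 = f n2"
    obtain m m' where mm: "f n1 = (m, m')" by force
    obtain q s where 1: "n1 = m * q" "n1 + k = m' * s" "prime q" "prime s" "\<not> q dvd m" "\<not> s dvd m'"
      using f[OF n(1)] mm by (auto simp: R_def)
    obtain q' s' where 2: "n2 = m * q'" "n2 + k = m' * s'" "prime q'" "prime s'" "\<not> q' dvd m" "\<not> s' dvd m'"
      using f[OF n(2)] mm n(3) by (auto simp: R_def)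
    have "q = q'"
    proof (rule prime_pair_unique[where s = s and s' = s'])
      show "m * totient m' \<noteq> m' * totient m" using nondeg[OF n(1) 1] .
      show "totient m * (q - 1) = totient m' * (s - 1)" using eqs[OF n(1) 1] .
      show "totient m * (q' - 1) = totient m' * (s' - 1)" using eqs[OF n(2) 2] .
      show "m * q + k = m' * s" "m * q' + k = m' * s'" using 1 2 by auto
    qed (use 1 2 prime_gt_0_nat in auto)
    thus "n1 = n2" using 1 2 by simp
  qed
  moreover have "f ` A \<subseteq> ?P"
  proof safe
    fix n m m' assume n: "n \<in> A" and mm: "(m, m') = f n"
    from f[OF n] mm[symmetric] obtain q s where
      1: "n = m * q" "n + k = m' * s" "prime q" "prime s" "real m * real m' \<le> z"
      by (auto simp: R_def)
    have n': "n > 0" "n \<le> X" using n by (auto simp: A_def)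
    have "m > 0" "m' > 0" using 1 n' by (auto intro!: Nat.gr0I)
    moreover have "m \<le> X" using 1 n' prime_gt_0_nat[OF 1(3)] by (metis dvd_imp_le dvd_triv_left le_trans)
    ultimately show "m \<in> {1..X}" "m' > 0" "real m * real m' \<le> z" using 1 by auto
  qed
  ultimately have "card A \<le> card ?P"
    by (intro card_inj_on_le card_pairs_le assms) auto
  thus ?thesis using card_pairs_le(2)[OF assms(2), of X] by linarith
qed

text \<open>
  For fixed primes \<open>q\<close> and \<open>s\<close> the condition fixes \<open>n\<close> modulo \<open>q * s\<close>, which leaves at most
  \<open>X / (q * s) + 1 \<le> 2 * X * E / (q * s)\<close> values. Writing \<open>q = d * u + 1\<close> and \<open>s = d * v + 1\<close> with
  \<open>d = gcd (q - 1) (s - 1)\<close>, the sum over the pairs is at most \<open>\<Sum> 1 / (d\<^sup>2 * u * v)\<close>, and the tail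
  \<open>d \<ge> D\<close> of \<open>\<Sum> 1 / d\<^sup>2\<close> gives the saving. The factor \<open>E\<close> allows the moduli \<open>q * s\<close> to exceed \<open>X\<close>
  slightly.
\<close>

lemma card_divisible_by_correlated_primes_le:
  fixes X k :: nat and D E :: real
  assumes "k \<le> X" "X \<ge> 1" "E \<ge> 1" "D > 0"
  defines "A \<equiv> {n \<in> {1..X}. \<exists>q s. prime q \<and> prime s \<and> q \<noteq> s \<and> q dvd n \<and> s dvd n + k \<and>
      real (gcd (q - 1) (s - 1)) \<ge> D \<and> real q * real s \<le> real X * E}"
  shows "real (card A) \<le> 4 * real X * E * (1 + ln (2 * real X))\<^sup>2 / D"
proof -
  define T where "T = nat \<lceil>D\<rceil>"
  have T: "real T \<ge> D" "T \<ge> 1" using assms(4) unfolding T_def by linarith+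
  define P where "P = {(q, s) \<in> {1..2*X} \<times> {1..2*X}. prime q \<and> prime s \<and> q \<noteq> s \<and>
      real (gcd (q - 1) (s - 1)) \<ge> D \<and> real q * real s \<le> real X * E}"
  define C where "C = (\<lambda>(q::nat, s::nat). {n \<in> {1..X}. q dvd n \<and> s dvd n + k})"
  have finP: "finite P" by (rule finite_subset[of _ "{1..2*X} \<times> {1..2*X}"]) (auto simp: P_def)
  have "A \<subseteq> (\<Union>x\<in>P. C x)"
  proof
    fix n assume "n \<in> A"
    then obtain q s where n: "n \<in> {1..X}" "prime q" "prime s" "q \<noteq> s" "q dvd n" "s dvd n + k"
      "real (gcd (q - 1) (s - 1)) \<ge> D" "real q * real s \<le> real X * E" unfolding A_def by blast
    have "q \<le> n" "s \<le> n + k" using n by (auto intro: dvd_imp_le)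
    hence "(q, s) \<in> P" using n assms prime_ge_1_nat unfolding P_def by auto
    moreover have "n \<in> C (q, s)" using n by (simp add: C_def)
    ultimately show "n \<in> (\<Union>x\<in>P. C x)" by blast
  qed
  hence "card A \<le> card (\<Union>x\<in>P. C x)"
    by (intro card_mono) (auto simp: finP C_def)
  also have "\<dots> \<le> (\<Sum>x\<in>P. card (C x))" by (rule card_UN_le[OF finP])
  finally have "real (card A) \<le> (\<Sum>x\<in>P. real (card (C x)))" by (simp flip: of_nat_sum)
  also have "\<dots> \<le> (\<Sum>x\<in>P. 2 * real X * E * (1 / (real (fst x) * real (snd x))))"
  proof (intro sum_mono)
    fix x assume "x \<in> P"
    then obtain q s where x: "x = (q, s)" and qs: "prime q" "prime s" "q \<noteq> s" "real q * real s \<le> real X * E"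
      by (auto simp: P_def)
    have pos: "real q > 0" "real s > 0" using qs prime_gt_0_nat by auto
    have "card (C x) \<le> X div (q * s) + 1"
    proof (rule card_congruent_le)
      show "C x \<subseteq> {..X}" by (auto simp: C_def x)
      fix a b assume ab: "a \<in> C x" "b \<in> C x"
      have "[a = b] (mod q)" using ab by (auto simp: C_def x cong_def)
      moreover have "[a + k = b + k] (mod s)" using ab by (auto simp: C_def x cong_def)
      hence "[a = b] (mod s)" by (simp add: cong_add_rcancel_nat)
      moreover have "coprime q s" using qs by (simp add: primes_coprime)
      ultimately have "[a = b] (mod q * s)" by (simp add: coprime_cong_mult_nat)
      thus "a mod (q * s) = b mod (q * s)" by (simp add: cong_def)
    qed
    hence "real (card (C x)) \<le> real (X div (q * s)) + 1" by linarith
    also have "\<dots> \<le> real X / (real q * real s) + 1"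
      using of_nat_div_le_of_nat[of X "q * s", where 'a = real] by simp
    also have "\<dots> \<le> real X * E / (real q * real s) + real X * E / (real q * real s)"
    proof (intro add_mono)
      show "real X / (real q * real s) \<le> real X * E / (real q * real s)"
        using assms pos by (intro divide_right_mono) (auto simp: mult_le_cancel_left1)
      show "1 \<le> real X * E / (real q * real s)" using qs pos by (simp add: field_simps)
    qed
    finally show "real (card (C x)) \<le> 2 * real X * E * (1 / (real (fst x) * real (snd x)))"
      by (simp add: x ac_simps)
  qed
  also have "\<dots> = 2 * real X * E * (\<Sum>x\<in>P. 1 / (real (fst x) * real (snd x)))"
    by (simp add: sum_distrib_left)
  also have "(\<Sum>x\<in>P. 1 / (real (fst x) * real (snd x))) \<le> (1 + ln (2 * real X))\<^sup>2 * (2 / D)"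
  proof -
    define I where "I = {T..2*X} \<times> {1..2*X} \<times> {1..2*X}"
    define g where "g = (\<lambda>(d, u, v). (d * u + 1, d * v + 1) :: nat \<times> nat)"
    let ?w = "\<lambda>x. 1 / (real (fst x) * real (snd x))"
    have "P \<subseteq> g ` I"
    proof safe
      fix q s assume "(q, s) \<in> P"
      hence qs: "q \<le> 2 * X" "s \<le> 2 * X" "prime q" "prime s" "real (gcd (q - 1) (s - 1)) \<ge> D"
        by (auto simp: P_def)
      define d where "d = gcd (q - 1) (s - 1)"
      obtain u v where uv: "q - 1 = d * u" "s - 1 = d * v"
        unfolding d_def by (meson dvdE gcd_dvd1 gcd_dvd2)
      have q1: "q > 1" "s > 1" using qs prime_gt_1_nat by auto
      hence nz: "d > 0" "u > 0" "v > 0" using uv by (auto intro!: Nat.gr0I)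
      have "u \<le> d * u" "v \<le> d * v" "d \<le> d * u" using nz by auto
      hence "u \<le> 2 * X" "v \<le> 2 * X" "d \<le> 2 * X" using uv qs by linarith+
      moreover have "d \<ge> T" using qs unfolding T_def d_def by linarith
      ultimately have "(d, u, v) \<in> I" using nz by (auto simp: I_def)
      moreover have "(q, s) = g (d, u, v)" 
      proof -
        have "q = d * u + 1" "s = d * v + 1" using uv q1 by linarith+
        thus ?thesis by (simp add: g_def)
      qed
      ultimately show "(q, s) \<in> g ` I" by blast
    qed
    hence "(\<Sum>x\<in>P. ?w x) \<le> (\<Sum>x\<in>g ` I. ?w x)"
      by (intro sum_mono2) (auto simp: I_def)
    also have "\<dots> \<le> (\<Sum>y\<in>I. ?w (g y))"
      using sum_image_le[of I ?w g] by (auto simp: I_def o_def)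
    also have "\<dots> \<le> (\<Sum>y\<in>I. case y of (d, u, v) \<Rightarrow> (1 / real d ^ 2) * ((1 / real u) * (1 / real v)))"
    proof (intro sum_mono)
      fix y assume "y \<in> I"
      then obtain d u v where y: "y = (d, u, v)" "d > 0" "u > 0" "v > 0"
        using T by (auto simp: I_def)
      have "(real d * real u) * (real d * real v) \<le> (real d * real u + 1) * (real d * real v + 1)"
        by (intro mult_mono) auto
      moreover have "0 < (real d * real u) * (real d * real v)" using y by simp
      ultimately have "1 / ((real d * real u + 1) * (real d * real v + 1)) \<le> 1 / ((real d * real u) * (real d * real v))"
        by (intro divide_left_mono) (auto intro!: mult_pos_pos simp: y add_pos_pos)
      thus "?w (g y) \<le> (case y of (d, u, v) \<Rightarrow> (1 / real d ^ 2) * ((1 / real u) * (1 / real v)))"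
        by (simp add: y g_def power2_eq_square ac_simps)
    qed
    also have "\<dots> = (\<Sum>d=T..2*X. 1 / real d ^ 2) * ((\<Sum>u=1..2*X. 1 / real u) * (\<Sum>v=1..2*X. 1 / real v))"
      unfolding I_def sum.cartesian_product[symmetric] sum_product by (simp add: sum_distrib_left)
    also have "\<dots> \<le> (2 / real T) * ((1 + ln (real (2 * X))) * (1 + ln (real (2 * X))))"
      using assms(2) by (intro mult_mono sum_inverse_squares_le T sum_inverse_le mult_nonneg_nonneg sum_nonneg) auto
    also have "\<dots> \<le> (2 / D) * ((1 + ln (real (2 * X))) * (1 + ln (real (2 * X))))"
      using T assms by (intro mult_right_mono divide_left_mono) auto
    finally show ?thesis by (simp add: power2_eq_square mult.commute)
  qed
  finally show ?thesis using assms by (simp add: mult_left_mono ac_simps)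
qed

text \<open>
  The terms of the bound are, in this order: small \<open>n\<close>; \<open>n\<close> or \<open>n + k\<close> with more than \<open>W\<close> prime
  factors; \<open>n\<close> or \<open>n + k\<close> with a large square divisor; and the two cases for the correlated primes
  \<open>q dvd n\<close> and \<open>s dvd n + k\<close> that all other solutions possess. If \<open>q * s \<le> X * E\<close>, such pairs are
  rare. If \<open>q * s > X * E\<close>, the product of the cofactors is at most \<open>2 * X / E\<close>, and the cofactors
  determine \<open>n\<close>.
\<close>

lemma card_equal_totient_shift_le:
  fixes X k W :: nat and H D E Q :: real
  assumes k: "k > 0" "k \<le> X" and H: "H \<ge> 1" "H\<^sup>2 \<le> D" and E: "E \<ge> H"
    and Q: "Q \<ge> H ^ 3" "Q \<ge> D ^ (2 * W) + 1" "Q \<ge> real k"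
  shows "real (card {n \<in> {1..X}. totient n = totient (n + k) \<and> k + 2 \<le> card (prime_factors n)}) \<le>
    Q ^ W + 4 * real X * (1 + ln (2 * real X)) / 2 ^ W + 8 * real X / H +
    4 * real X * E * (1 + ln (2 * real X))\<^sup>2 / D + 2 * real X / E * (1 + ln (2 * real X))"
proof -
  define T where "T = {n \<in> {1..X}. totient n = totient (n + k) \<and> k + 2 \<le> card (prime_factors n)}"
  define A1 where "A1 = {n \<in> {1..X}. real n \<le> Q ^ W}"
  define A2 where "A2 = {n \<in> {1..X}. W < card (prime_factors n)}"
  define A3 where "A3 = {n \<in> {1..X}. W < card (prime_factors (n + k))}"
  define A4 where "A4 = {n \<in> {1..X}. \<exists>t. real t \<ge> H \<and> t\<^sup>2 dvd n}"
  define A5 where "A5 = {n \<in> {1..X}. \<exists>t. real t \<ge> H \<and> t\<^sup>2 dvd n + k}"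
  define A6 where "A6 = {n \<in> {1..X}. \<exists>q s. prime q \<and> prime s \<and> q \<noteq> s \<and> q dvd n \<and> s dvd n + k \<and>
      real (gcd (q - 1) (s - 1)) \<ge> D \<and> real q * real s \<le> real X * E}"
  define z where "z = 2 * real X / E"
  define A7 where "A7 = {n \<in> {1..X}. totient n = totient (n + k) \<and> k + 2 \<le> card (prime_factors n) \<and>
      (\<exists>m q m' s. n = m * q \<and> n + k = m' * s \<and> prime q \<and> prime s \<and> \<not> q dvd m \<and> \<not> s dvd m' \<and>
         real m * real m' \<le> z)}"
  note A_defs = A1_def A2_def A3_def A4_def A5_def A6_def A7_def
  define Z where "Z = X + k"
  have Z: "real Z \<le> 2 * real X" "Z \<ge> 1" "X \<ge> 1" using k by (auto simp: Z_def)
  have E1: "E \<ge> 1" "E > 0" using H E by auto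
  have D1: "D \<ge> 1" using H one_le_power[of H 2] by linarith
  have Q1: "Q \<ge> 1" using Q H one_le_power[of H 3] by linarith
  have "T \<subseteq> A1 \<union> A2 \<union> A3 \<union> A4 \<union> A5 \<union> A6 \<union> A7"
  proof (rule subsetI, rule ccontr)
    fix n assume nT: "n \<in> T" and "n \<notin> A1 \<union> A2 \<union> A3 \<union> A4 \<union> A5 \<union> A6 \<union> A7"
    hence nA: "n \<notin> A1" "n \<notin> A2" "n \<notin> A3" "n \<notin> A4" "n \<notin> A5" "n \<notin> A6" "n \<notin> A7" by blast+
    have n: "n \<in> {1..X}" "totient n = totient (n + k)" "k + 2 \<le> card (prime_factors n)"
      using nT by (auto simp: T_def)
    have "\<exists>q s. prime q \<and> q dvd n \<and> \<not> q\<^sup>2 dvd n \<and> real q > Q \<and> prime s \<and> s dvd n + k \<and>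
           real (gcd (q - 1) (s - 1)) \<ge> D"
    proof (rule exists_prime_factors_with_large_gcd[OF _ _ n(2) _ _ _ _ H Q(1,2)])
      show "card (prime_factors n) \<le> W" "card (prime_factors (n + k)) \<le> W" "real n > Q ^ W"
        using nA n by (simp_all add: A_defs)
      show "\<not> t\<^sup>2 dvd n" "\<not> t\<^sup>2 dvd n + k" if "real t \<ge> H" for t
        using nA n that by (auto simp: A_defs)
    qed (use n k in auto)
    then obtain q s where qs: "prime q" "q dvd n" "\<not> q\<^sup>2 dvd n" "real q > Q" "prime s" "s dvd n + k"
      "real (gcd (q - 1) (s - 1)) \<ge> D" by blast
    have "q \<noteq> s"
    proof
      assume "q = s"
      hence "q dvd k" using qs by (simp add: dvd_add_right_iff)
      hence "q \<le> k" using k by (simp add: dvd_imp_le)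
      thus False using qs Q by simp
    qed
    have "\<not> real q * real s \<le> real X * E"
      using nA(6) n(1) qs \<open>q \<noteq> s\<close> unfolding A6_def by blast
    hence big: "real X * E < real q * real s" by simp
    have "q \<le> X" using dvd_imp_le[OF qs(2)] n(1) by simp
    have "E < real s"
    proof (rule ccontr)
      assume "\<not> E < real s"
      hence "real q * real s \<le> real X * E" using \<open>q \<le> X\<close> by (intro mult_mono) auto
      thus False using big by simp
    qed
    hence "\<not> s\<^sup>2 dvd n + k" using nA(5) n(1) E by (auto simp: A5_def)
    obtain m m' where m: "n = m * q" "n + k = m' * s" using qs by (metis dvdE mult.commute)
    have nd: "\<not> q dvd m" "\<not> s dvd m'"
      using m \<open>\<not> s\<^sup>2 dvd n + k\<close> qs(3) by (auto simp: power2_eq_square mult_dvd_mono)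
    have "real m * real m' * (real X * E) \<le> (real m * real m') * (real q * real s)"
      using big by (intro mult_left_mono) auto
    also have "\<dots> = real n * real (n + k)" using m by (simp add: ac_simps)
    also have "\<dots> \<le> real X * (2 * real X)" using n(1) k by (intro mult_mono) auto
    finally have "real X * (real m * real m' * E) \<le> real X * (2 * real X)" by (simp add: ac_simps)
    hence "real m * real m' * E \<le> 2 * real X" using Z by simp
    hence "real m * real m' \<le> z" using E1 by (simp add: z_def field_simps)
    hence "n \<in> A7" using n m qs nd unfolding A7_def by blast
    thus False using nA by blast
  qed
  moreover have fin: "finite A1" "finite A2" "finite A3" "finite A4" "finite A5" "finite A6" "finite A7"
    by (simp_all add: A_defs)
  ultimately have "card T \<le> card (A1 \<union> A2 \<union> A3 \<union> A4 \<union> A5 \<union> A6 \<union> A7)"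
    by (intro card_mono) auto
  also have "\<dots> \<le> card A1 + card A2 + card A3 + card A4 + card A5 + card A6 + card A7"
    by (intro order_trans[OF card_Un_le] add_right_mono order_refl)
  finally have "real (card T) \<le> real (card A1) + real (card A2) + real (card A3) + real (card A4)
      + real (card A5) + real (card A6) + real (card A7)"
    by (simp only: of_nat_le_iff flip: of_nat_add)
  also have "\<dots> \<le> Q ^ W + real Z * (1 + ln (real Z)) / 2 ^ W + real Z * (1 + ln (real Z)) / 2 ^ W +
     2 * real Z / H + 2 * real Z / H + 4 * real X * E * (1 + ln (2 * real X))\<^sup>2 / D + z * (1 + ln (real X))"
  proof (intro add_mono)
    have "A1 \<subseteq> {1..nat \<lfloor>Q ^ W\<rfloor>}" by (auto simp: A1_def le_nat_floor)
    hence "card A1 \<le> card {1..nat \<lfloor>Q ^ W\<rfloor>}" by (intro card_mono) auto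
    moreover have "real (nat \<lfloor>Q ^ W\<rfloor>) \<le> Q ^ W" using Q1 by (intro of_nat_floor) simp
    ultimately show "real (card A1) \<le> Q ^ W" by simp
    have "A2 \<subseteq> {n \<in> {1..Z}. W < card (prime_factors n)}" by (auto simp: A2_def Z_def)
    hence "card A2 \<le> card {n \<in> {1..Z}. W < card (prime_factors n)}" by (intro card_mono) auto
    thus "real (card A2) \<le> real Z * (1 + ln (real Z)) / 2 ^ W"
      using card_many_prime_factors_le[of Z W] by linarith
    have "card A3 \<le> card {n \<in> {1..Z}. W < card (prime_factors n)}"
      unfolding A3_def Z_def by (rule card_shift_le)
    thus "real (card A3) \<le> real Z * (1 + ln (real Z)) / 2 ^ W"
      using card_many_prime_factors_le[of Z W] by linarith
    have "A4 \<subseteq> {n \<in> {1..Z}. \<exists>t. real t \<ge> H \<and> t\<^sup>2 dvd n}" by (auto simp: A4_def Z_def)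
    hence "card A4 \<le> card {n \<in> {1..Z}. \<exists>t. real t \<ge> H \<and> t\<^sup>2 dvd n}" by (intro card_mono) auto
    thus "real (card A4) \<le> 2 * real Z / H"
      using card_divisible_by_large_square_le[of H Z] H by linarith
    have "card A5 \<le> card {n \<in> {1..Z}. \<exists>t. real t \<ge> H \<and> t\<^sup>2 dvd n}"
      unfolding A5_def Z_def by (rule card_shift_le)
    thus "real (card A5) \<le> 2 * real Z / H"
      using card_divisible_by_large_square_le[of H Z] H by linarith
    show "real (card A6) \<le> 4 * real X * E * (1 + ln (2 * real X))\<^sup>2 / D"
      unfolding A6_def using Z k E1 D1 by (intro card_divisible_by_correlated_primes_le) auto
    show "real (card A7) \<le> z * (1 + ln (real X))"
      unfolding A7_def using k E1 by (intro card_determined_by_cofactors_le) (auto simp: z_def)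
  qed
  also have "\<dots> \<le> Q ^ W + (2 * real X) * (1 + ln (2 * real X)) / 2 ^ W + (2 * real X) * (1 + ln (2 * real X)) / 2 ^ W +
     2 * (2 * real X) / H + 2 * (2 * real X) / H + 4 * real X * E * (1 + ln (2 * real X))\<^sup>2 / D + z * (1 + ln (2 * real X))"
    using Z H E1 by (intro add_mono divide_right_mono mult_mono mult_left_mono order_refl) (auto simp: z_def)
  also have "\<dots> = Q ^ W + 4 * real X * (1 + ln (2 * real X)) / 2 ^ W + 8 * real X / H +
    4 * real X * E * (1 + ln (2 * real X))\<^sup>2 / D + 2 * real X / E * (1 + ln (2 * real X))"
    by (simp add: z_def field_simps)
  finally show ?thesis unfolding T_def .
qed

text \<open>
  With \<open>L = ln X\<close> the choice is \<open>H = E = L ^ 4\<close>, \<open>D = L ^ 9\<close>, \<open>W = \<lceil>8 * ln L\<rceil>\<close>, \<open>Q = D ^ (3 * W)\<close>.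
  The powers of \<open>L\<close> make every term of the preceding bound but \<open>Q ^ W\<close> smaller than \<open>X / L\<^sup>2\<close> by a
  power of \<open>L\<close> (note \<open>2 ^ W \<ge> L ^ 5\<close> since \<open>8 * ln 2 > 5\<close>), while \<open>Q ^ W\<close> is at most the exponential of
  a cubic polynomial in \<open>ln L\<close> and hence smaller than any power of \<open>X\<close>.
\<close>

lemma card_equal_totient_shift_smallo:
  fixes k :: nat
  assumes "k > 0"
  shows "(\<lambda>X. real (card {n \<in> {1..X}. totient n = totient (n + k) \<and> k + 2 \<le> card (prime_factors n)}))
           \<in> o(\<lambda>X. real X / ln (real X) ^ 2)"
proof -
  define b where "b = (\<lambda>x::real. exp (27 * (8 * ln (ln x) + 1)\<^sup>2 * ln (ln x)) +
     4 * x * (1 + ln (2 * x)) / ln x powr (8 * ln 2) + 8 * x / ln x ^ 4 +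
     4 * x * ln x ^ 4 * (1 + ln (2 * x))\<^sup>2 / ln x ^ 9 + 2 * x / ln x ^ 4 * (1 + ln (2 * x)))"
  have ln2: "8 * ln 2 > (5::real)" using ln2_ge_two_thirds by simp
  have b: "b \<in> o(\<lambda>x. x / ln x ^ 2)"
  proof -
    have "(\<lambda>x::real. exp (27 * (8 * ln (ln x) + 1)\<^sup>2 * ln (ln x))) \<in> o(\<lambda>x. x / ln x ^ 2)"
      by real_asymp
    moreover have "(\<lambda>x::real. 4 * x * (1 + ln (2 * x)) / ln x powr (8 * ln 2)) \<in> o(\<lambda>x. x / ln x ^ 2)"
    proof -
      have "(\<lambda>x::real. 4 * x * (1 + ln (2 * x)) / ln x powr (8 * ln 2)) \<in> O(\<lambda>x. 4 * x * (1 + ln (2 * x)) / ln x powr 5)"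
      proof (rule landau_o.big_mono)
        have "eventually (\<lambda>x::real. ln x \<ge> 1) at_top" by real_asymp
        thus "eventually (\<lambda>x::real. norm (4 * x * (1 + ln (2 * x)) / ln x powr (8 * ln 2)) \<le>
            norm (4 * x * (1 + ln (2 * x)) / ln x powr 5)) at_top"
        proof eventually_elim
          case (elim x)
          have "ln x powr 5 \<le> ln x powr (8 * ln 2)" using elim ln2 by (intro powr_mono) auto
          thus ?case using elim by (auto simp: norm_divide intro!: divide_left_mono mult_pos_pos)
        qed
      qed
      also have "(\<lambda>x::real. 4 * x * (1 + ln (2 * x)) / ln x powr 5) \<in> o(\<lambda>x. x / ln x ^ 2)" by real_asymp
      finally show ?thesis .
    qed
    moreover have "(\<lambda>x::real. 8 * x / ln x ^ 4) \<in> o(\<lambda>x. x / ln x ^ 2)" by real_asymp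
    moreover have "(\<lambda>x::real. 4 * x * ln x ^ 4 * (1 + ln (2 * x))\<^sup>2 / ln x ^ 9) \<in> o(\<lambda>x. x / ln x ^ 2)" by real_asymp
    moreover have "(\<lambda>x::real. 2 * x / ln x ^ 4 * (1 + ln (2 * x))) \<in> o(\<lambda>x. x / ln x ^ 2)" by real_asymp
    ultimately show ?thesis unfolding b_def by (intro sum_in_smallo)
  qed
  \<comment> \<open>The bound is needed at integers only, but the asymptotic estimates are those of functions of a real
    variable; the disjunction restricts a real \<open>x\<close> to integer values.\<close>
  have "eventually (\<lambda>x::real. real (card {n \<in> {1..nat \<lfloor>x\<rfloor>}. totient n = totient (n + k) \<and> k + 2 \<le> card (prime_factors n)}) \<le> b x \<or> x \<noteq> real (nat \<lfloor>x\<rfloor>)) at_top"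
  proof -
    have "eventually (\<lambda>x::real. ln x \<ge> 2) at_top" "eventually (\<lambda>x::real. ln x \<ge> real k) at_top"
      "eventually (\<lambda>x::real. x \<ge> real k) at_top" "eventually (\<lambda>x::real. ln (ln x) \<ge> 1) at_top"
      by real_asymp+
    thus ?thesis
    proof eventually_elim
      case (elim x)
      show ?case
      proof (cases "x = real (nat \<lfloor>x\<rfloor>)")
        case True
        define X where "X = nat \<lfloor>x\<rfloor>"
        have x: "x = real X" using True by (simp add: X_def)
        define L where "L = ln x"
        define W where "W = nat \<lceil>8 * ln L\<rceil>"
        have L: "L \<ge> 2" "L \<ge> real k" "ln L \<ge> 1" using elim by (auto simp: L_def)
        have W: "real W \<ge> 8 * ln L" "real W \<le> 8 * ln L + 1" using L unfolding W_def by linarith+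
        have W1: "W \<ge> 1" using W L by linarith
        define D where "D = L ^ 9"
        define Q where "Q = D ^ (3 * W)"
        have D: "D \<ge> L" "D \<ge> 2"
          unfolding D_def using L self_le_power[of L 9] by auto
        have QD: "Q \<ge> D ^ 3" unfolding Q_def using D W1 by (intro power_increasing) auto
        have "real (card {n \<in> {1..X}. totient n = totient (n + k) \<and> k + 2 \<le> card (prime_factors n)}) \<le>
          Q ^ W + 4 * real X * (1 + ln (2 * real X)) / 2 ^ W + 8 * real X / (L ^ 4) +
          4 * real X * (L ^ 4) * (1 + ln (2 * real X))\<^sup>2 / D + 2 * real X / (L ^ 4) * (1 + ln (2 * real X))"
        proof (rule card_equal_totient_shift_le[OF assms])
          show "k \<le> X" using elim x by simp
          show "1 \<le> L ^ 4" using L by simp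
          show "(L ^ 4)\<^sup>2 \<le> D" unfolding D_def power_mult[symmetric]
            using L by (intro power_increasing) auto
          have "(L ^ 4) ^ 3 \<le> (L ^ 9) ^ 3"
            using L by (intro power_mono power_increasing) auto
          thus "(L ^ 4) ^ 3 \<le> Q" using QD by (simp add: D_def)
          have "D \<le> D ^ 3" using D self_le_power[of D 3] by auto
          thus "real k \<le> Q" using QD D L by linarith
          have "D ^ (2 * W) \<ge> 1" using D by simp
          moreover have "D ^ (2 * W) * 2 \<le> D ^ (2 * W) * D ^ W"
            using D W1 self_le_power[of D W] by (intro mult_left_mono) auto
          moreover have "D ^ (2 * W) * D ^ W = Q" unfolding Q_def by (simp flip: power_add)
          ultimately show "D ^ (2 * W) + 1 \<le> Q" by linarith
        qed auto
        moreover have "Q ^ W \<le> exp (27 * (8 * ln L + 1)\<^sup>2 * ln L)"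
        proof -
          have "Q ^ W = L ^ (27 * W ^ 2)"
            by (simp add: Q_def D_def power2_eq_square ac_simps flip: power_mult)
          also have "\<dots> = exp (real (27 * W ^ 2) * ln L)"
            using L by (subst exp_of_nat_mult) simp
          also have "\<dots> \<le> exp (27 * (8 * ln L + 1)\<^sup>2 * ln L)"
          proof -
            have "real W ^ 2 \<le> (8 * ln L + 1) ^ 2" using W by (intro power_mono) auto
            thus ?thesis using L by (simp add: mult_right_mono)
          qed
          finally show ?thesis .
        qed
        moreover have "4 * real X * (1 + ln (2 * real X)) / 2 ^ W \<le> 4 * real X * (1 + ln (2 * real X)) / L powr (8 * ln 2)"
        proof -
          have "L powr (8 * ln 2) = 2 powr (8 * ln L)" using L by (simp add: powr_def)
          also have "\<dots> \<le> 2 powr real W" using W by (intro powr_mono) auto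
          also have "\<dots> = 2 ^ W" by (simp add: powr_realpow)
          finally have "L powr (8 * ln 2) \<le> 2 ^ W" .
          moreover have "X > 0"
          proof (rule Nat.gr0I)
            assume "X = 0" thus False using x L by (simp add: L_def)
          qed
          ultimately show ?thesis using L by (intro divide_left_mono mult_nonneg_nonneg mult_pos_pos) auto
        qed
        moreover have "b x = exp (27 * (8 * ln L + 1)\<^sup>2 * ln L) +
            4 * real X * (1 + ln (2 * real X)) / L powr (8 * ln 2) + 8 * real X / (L ^ 4) +
            4 * real X * (L ^ 4) * (1 + ln (2 * real X))\<^sup>2 / D + 2 * real X / (L ^ 4) * (1 + ln (2 * real X))"
          unfolding b_def L_def D_def x ..
        ultimately have "real (card {n \<in> {1..X}. totient n = totient (n + k) \<and> k + 2 \<le> card (prime_factors n)}) \<le> b x"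
          by linarith
        thus ?thesis unfolding X_def by blast
      qed auto
    qed
  qed
  hence "eventually (\<lambda>X. real (card {n \<in> {1..X}. totient n = totient (n + k) \<and> k + 2 \<le> card (prime_factors n)}) \<le> b (real X)) sequentially"
    using filterlim_real_sequentially unfolding filterlim_iff by fastforce
  hence "(\<lambda>X. real (card {n \<in> {1..X}. totient n = totient (n + k) \<and> k + 2 \<le> card (prime_factors n)})) \<in> O(\<lambda>X. b (real X))"
    by (intro landau_o.big_mono) (auto elim!: eventually_mono intro: order_trans)
  also have "(\<lambda>X. b (real X)) \<in> o(\<lambda>X. real X / ln (real X) ^ 2)"
    using b filterlim_real_sequentially by (rule landau_o.small.compose)
  finally show ?thesis .
qed

section \<open>Euler products and residue classes\<close>

text \<open>
  Half of Euler's product formula. Inductive step: if \<open>f P\<close> is the sum over the \<open>P\<close>-smooth numbers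
  \<open>n \<le> y\<close>, the terms of \<open>f (insert p P)\<close> that are divisible by \<open>p\<close> contribute at most
  \<open>f (insert p P) / p\<close>, and the others at most \<open>f P\<close>.
\<close>

lemma sum_inverse_smooth_le:
  fixes P :: "nat set"
  assumes "finite P" "\<And>p. p \<in> P \<Longrightarrow> prime p"
  shows "(\<Sum>n | n \<in> {1..y} \<and> prime_factors n \<subseteq> P. 1 / real n) * (\<Prod>p\<in>P. 1 - 1 / real p) \<le> 1"
  using assms
proof (induction P rule: finite_induct)
  case empty
  have "{n. n \<in> {1..y} \<and> prime_factors n \<subseteq> {}} \<subseteq> {1}"
    by (auto simp: prime_factorization_empty_iff)
  hence "(\<Sum>n | n \<in> {1..y} \<and> prime_factors n \<subseteq> {}. 1 / real n) \<le> (\<Sum>n\<in>{1}. 1 / real n)"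
    by (intro sum_mono2) auto
  thus ?case by simp
next
  case (insert p P)
  let ?S = "\<lambda>P. {n. n \<in> {1..y} \<and> prime_factors n \<subseteq> P}"
  let ?f = "\<lambda>P. \<Sum>n\<in>?S P. 1 / real n"
  have pp: "prime p" using insert by simp
  have p1: "real p > 1" using prime_gt_1_nat[OF pp] by simp
  have "?S (insert p P) \<subseteq> ?S P \<union> (\<lambda>m. p * m) ` ?S (insert p P)"
  proof
    fix n assume n: "n \<in> ?S (insert p P)"
    show "n \<in> ?S P \<union> (\<lambda>m. p * m) ` ?S (insert p P)"
    proof (cases "p dvd n")
      case False
      hence "p \<notin> prime_factors n" by auto
      thus ?thesis using n by auto
    next
      case True
      then obtain m where m: "n = p * m" by auto
      have "m > 0" using m n by (auto intro: Nat.gr0I)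
      moreover have "m \<le> y" using m n prime_gt_0_nat[OF pp]
        by (metis (no_types, lifting) atLeastAtMost_iff dvd_imp_le dvd_triv_right le_trans mem_Collect_eq less_le_trans zero_less_one)
      moreover have "prime_factors m \<subseteq> prime_factors n"
        using m n by (intro dvd_prime_factors) auto
      ultimately have "m \<in> ?S (insert p P)" using n by auto
      thus ?thesis using m by blast
    qed
  qed
  hence "?f (insert p P) \<le> (\<Sum>n\<in>?S P \<union> (\<lambda>m. p * m) ` ?S (insert p P). 1 / real n)"
    by (intro sum_mono2) auto
  also have "\<dots> \<le> ?f P + (\<Sum>n\<in>(\<lambda>m. p * m) ` ?S (insert p P). 1 / real n)"
    by (subst sum.union_inter[symmetric]) (auto intro: sum_nonneg)
  also have "(\<Sum>n\<in>(\<lambda>m. p * m) ` ?S (insert p P). 1 / real n) = (\<Sum>m\<in>?S (insert p P). 1 / real (p * m))"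
    using p1 by (subst sum.reindex) (auto simp: inj_on_def)
  also have "\<dots> = 1 / real p * ?f (insert p P)" by (simp add: sum_distrib_left)
  finally have "?f (insert p P) * (1 - 1 / real p) \<le> ?f P" by (simp add: algebra_simps)
  moreover have "0 \<le> (\<Prod>p\<in>P. 1 - 1 / real p)"
  proof (intro prod_nonneg)
    fix r assume "r \<in> P"
    hence "real r \<ge> 1" using insert prime_ge_1_nat[of r] by simp
    thus "0 \<le> 1 - 1 / real r" by simp
  qed
  ultimately have "?f (insert p P) * (1 - 1 / real p) * (\<Prod>p\<in>P. 1 - 1 / real p) \<le> ?f P * (\<Prod>p\<in>P. 1 - 1 / real p)"
    by (rule mult_right_mono)
  also have "\<dots> \<le> 1" using insert by simp
  finally show ?case using insert by (simp add: mult.assoc)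
qed

text \<open>
  The product over all primes up to \<open>y\<close> is at most the inverse of a harmonic sum, so it tends to 0, and
  omitting the finitely many primes up to \<open>y\<^sub>0\<close> changes it by a constant factor.
\<close>

lemma exists_primes_with_small_Euler_product:
  fixes \<epsilon> :: real
  assumes "\<epsilon> > 0"
  shows "\<exists>B. finite B \<and> (\<forall>p\<in>B. prime p \<and> p > (y\<^sub>0::nat)) \<and> (\<Prod>p\<in>B. 1 - 1 / real p) < \<epsilon>"
proof -
  let ?g = "\<lambda>p::nat. 1 - 1 / real p"
  define S where "S = {p. prime p \<and> p \<le> y\<^sub>0}"
  have finS: "finite S" by (rule finite_subset[of _ "{..y\<^sub>0}"]) (auto simp: S_def)
  define c where "c = (\<Prod>p\<in>S. ?g p)"
  have gpos: "?g p > 0" if "prime p" for p using prime_gt_1_nat[OF that] by simp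
  have c: "c > 0" unfolding c_def using gpos by (intro prod_pos) (auto simp: S_def)
  have "eventually (\<lambda>n. harm n > 1 / (\<epsilon> * c)) sequentially"
    using harm_at_top unfolding filterlim_at_top_dense by blast
  then obtain y where y: "harm y > 1 / (\<epsilon> * c)" by (auto simp: eventually_sequentially)
  define P where "P = {p. prime p \<and> p \<le> max y y\<^sub>0}"
  have finP: "finite P" by (rule finite_subset[of _ "{..max y y\<^sub>0}"]) (auto simp: P_def)
  have "prime_factors n \<subseteq> P" if "n \<in> {1..y}" for n
  proof
    fix p assume "p \<in> prime_factors n"
    hence "prime p" "p dvd n" by auto
    thus "p \<in> P" using that dvd_imp_le[of p n] by (auto simp: P_def)
  qed
  hence "{n. n \<in> {1..y} \<and> prime_factors n \<subseteq> P} = {1..y}" by blast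
  hence "harm y * (\<Prod>p\<in>P. ?g p) \<le> 1"
    using sum_inverse_smooth_le[OF finP, of y] by (simp add: P_def harm_def field_simps)
  moreover have "P = S \<union> (P - S)" by (auto simp: P_def S_def)
  hence "(\<Prod>p\<in>P. ?g p) = c * (\<Prod>p\<in>P - S. ?g p)"
    unfolding c_def using finS finP by (metis Diff_disjoint finite_Diff prod.union_disjoint)
  ultimately have *: "harm y * (c * (\<Prod>p\<in>P - S. ?g p)) \<le> 1" by simp
  have pos: "(\<Prod>p\<in>P - S. ?g p) > 0" using gpos by (intro prod_pos) (auto simp: P_def)
  have "1 / (\<epsilon> * c) * (c * (\<Prod>p\<in>P - S. ?g p)) < harm y * (c * (\<Prod>p\<in>P - S. ?g p))"
    using y c pos by (intro mult_strict_right_mono) auto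
  hence "1 / (\<epsilon> * c) * (c * (\<Prod>p\<in>P - S. ?g p)) < 1" using * by linarith
  hence "(\<Prod>p\<in>P - S. ?g p) < \<epsilon>" using c assms by (simp add: field_simps)
  moreover have "\<forall>p\<in>P - S. prime p \<and> p > y\<^sub>0" by (auto simp: P_def S_def)
  ultimately show ?thesis using finP by blast
qed

lemma card_residues_prod:
  fixes B :: "nat set" and S :: "nat \<Rightarrow> nat set"
  assumes "finite B" "\<And>l. l \<in> B \<Longrightarrow> prime l" "\<And>l. l \<in> B \<Longrightarrow> S l \<subseteq> {..<l}"
  shows "card {a. a < \<Prod>B \<and> (\<forall>l\<in>B. a mod l \<in> S l)} = (\<Prod>l\<in>B. card (S l))"
  using assms
proof (induction B rule: finite_induct)
  case empty
  have "{a::nat. a < 1} = {0}" by auto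
  thus ?case by simp
next
  case (insert q B)
  define M where "M = \<Prod>B"
  let ?A = "\<lambda>B. {a. a < \<Prod>B \<and> (\<forall>l\<in>B. a mod l \<in> S l)}"
  have Mpos: "M > 0" unfolding M_def using insert by (intro prod_pos) (auto simp: prime_gt_0_nat)
  have qpos: "q > 0" using insert prime_gt_0_nat by auto
  have "coprime q l" if "l \<in> B" for l using insert that by (intro primes_coprime) auto
  hence cop: "coprime q M" unfolding M_def by (rule prod_coprime_right)
  have modl: "(a mod M) mod l = a mod l" if "l \<in> B" for a l
    using that insert by (intro mod_mod_cancel) (auto simp: M_def dvd_prodI)
  have ins: "\<Prod>(insert q B) = q * M" using insert by (simp add: M_def)
  have "bij_betw (\<lambda>a. (a mod q, a mod M)) (?A (insert q B)) (S q \<times> ?A B)"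
    unfolding bij_betw_def
  proof
    show "inj_on (\<lambda>a. (a mod q, a mod M)) (?A (insert q B))"
    proof (intro inj_onI)
      fix a b assume ab: "a \<in> ?A (insert q B)" "b \<in> ?A (insert q B)" "(a mod q, a mod M) = (b mod q, b mod M)"
      hence "[a = b] (mod q)" "[a = b] (mod M)" by (auto simp: cong_def)
      hence "[a = b] (mod q * M)" using cop by (simp add: coprime_cong_mult_nat)
      thus "a = b" using ab ins by (simp add: cong_def)
    qed
    show "(\<lambda>a. (a mod q, a mod M)) ` ?A (insert q B) = S q \<times> ?A B"
    proof (intro equalityI subsetI)
      fix x assume "x \<in> (\<lambda>a. (a mod q, a mod M)) ` ?A (insert q B)"
      thus "x \<in> S q \<times> ?A B" using Mpos modl by (auto simp: M_def[symmetric])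
    next
      fix x assume "x \<in> S q \<times> ?A B"
      then obtain r b where x: "x = (r, b)" "r \<in> S q" "b < M" "\<forall>l\<in>B. b mod l \<in> S l"
        by (auto simp: M_def)
      obtain a where a: "a < q * M" "[a = r] (mod q)" "[a = b] (mod M)"
        using binary_chinese_remainder_unique_nat[OF cop] qpos Mpos by blast
      have "r < q" using x insert by blast
      hence am: "a mod q = r" "a mod M = b" using a x by (auto simp: cong_def)
      moreover have "a mod l \<in> S l" if "l \<in> B" for l by (metis am(2) modl that x(4))
      ultimately have "a \<in> ?A (insert q B)" using a x by (simp add: ins)
      thus "x \<in> (\<lambda>a. (a mod q, a mod M)) ` ?A (insert q B)" using am x by force
    qed
  qed
  hence "card (?A (insert q B)) = card (S q \<times> ?A B)" by (rule bij_betw_same_card)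
  also have "\<dots> = card (S q) * (\<Prod>l\<in>B. card (S l))"
    using insert by (simp add: card_cartesian_product)
  finally show ?case using insert by simp
qed

text \<open>
  For prime \<open>l\<close>, the residue classes modulo \<open>l\<close> that can contain a prime \<open>p > l\<close> with \<open>p + k\<close> also prime.
\<close>

definition pair_residues :: "nat \<Rightarrow> nat \<Rightarrow> nat set" where
  "pair_residues k l = {r. r < l \<and> \<not> l dvd r \<and> \<not> l dvd r + k}"

text \<open>
  The congruence \<open>r + h = 1\<close> modulo \<open>l\<close> means that \<open>l\<close> divides \<open>r + h - 1\<close>. For both values of \<open>h\<close> its
  solution \<open>r\<^sub>0\<close> lies in \<open>pair_residues k l\<close>, so removing it leaves at most a proportion \<open>1 - 1 / l\<close>.
\<close>

lemma card_pair_residues_avoiding_le: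
  fixes k l h :: nat
  assumes "prime l" "l > k + 1" "h = 0 \<or> h = k" "k > 0" "even k"
  shows "real (card {r \<in> pair_residues k l. \<not> [r + h = 1] (mod l)}) \<le> (1 - 1 / real l) * real (card (pair_residues k l))"
    and "card (pair_residues k l) > 0"
proof -
  let ?S = "pair_residues k l"
  have fin: "finite ?S" by (simp add: pair_residues_def)
  define r\<^sub>0 where "r\<^sub>0 = (if h = 0 then 1 else l + 1 - k)"
  have k2: "k \<ge> 2" using assms by (elim evenE) auto
  have "r\<^sub>0 \<in> ?S"
  proof (cases "h = 0")
    case True
    thus ?thesis using assms k2 by (auto simp: r\<^sub>0_def pair_residues_def dest: dvd_imp_le)
  next
    case False
    have "\<not> l dvd l + 1" by (metis assms(1) dvd_add_triv_left_iff not_prime_unit)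
    hence "\<not> l dvd r\<^sub>0 + k" using False assms by (simp add: r\<^sub>0_def)
    thus ?thesis using False assms k2 by (auto simp: r\<^sub>0_def pair_residues_def dest: dvd_imp_le)
  qed
  thus card0: "card ?S > 0" using fin card_gt_0_iff by blast
  have "[r\<^sub>0 + h = 1] (mod l)"
  proof (cases "h = 0")
    case False
    hence "r\<^sub>0 + h = l + 1" using assms by (simp add: r\<^sub>0_def)
    thus ?thesis by (simp only: cong_def mod_add_self1)
  qed (simp add: r\<^sub>0_def)
  hence "{r \<in> ?S. \<not> [r + h = 1] (mod l)} \<subseteq> ?S - {r\<^sub>0}" by auto
  hence "card {r \<in> ?S. \<not> [r + h = 1] (mod l)} \<le> card (?S - {r\<^sub>0})"
    using fin by (intro card_mono) auto
  also have "\<dots> = card ?S - 1" using \<open>r\<^sub>0 \<in> ?S\<close> by simp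
  finally have "real (card {r \<in> ?S. \<not> [r + h = 1] (mod l)}) \<le> real (card ?S) - 1" using card0 by linarith
  also have "\<dots> \<le> (1 - 1 / real l) * real (card ?S)"
  proof -
    have "card ?S \<le> card {..<l}" by (intro card_mono) (auto simp: pair_residues_def)
    hence "real (card ?S) / real l \<le> 1" using assms by simp
    thus ?thesis by (simp add: algebra_simps)
  qed
  finally show "real (card {r \<in> ?S. \<not> [r + h = 1] (mod l)}) \<le> (1 - 1 / real l) * real (card ?S)" .
qed

section \<open>The Bateman--Horn asymptotics for prime pairs in a progression\<close>

definition progression_pair :: "nat \<Rightarrow> nat \<Rightarrow> nat \<Rightarrow> int poly set" where
  "progression_pair k M a = {[:int a, int M:], [:int (a + k), int M:]}"

text \<open>
  The local factor of \<open>progression_pair k M a\<close> at \<open>p\<close> in the Bateman--Horn constant. For \<open>a\<close> and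
  \<open>a + k\<close> coprime to \<open>M\<close> it does not depend on \<open>a\<close>, which is what makes the classes modulo \<open>M\<close>
  comparable.
\<close>

definition pair_local_factor :: "nat \<Rightarrow> nat \<Rightarrow> nat \<Rightarrow> real" where
  "pair_local_factor k M p =
     (1 - (if p dvd M then 0 else if p dvd k then 1 else 2) / real p) / (1 - 1 / real p)\<^sup>2"

definition pair_constant :: "nat \<Rightarrow> nat \<Rightarrow> real" where
  "pair_constant k M = lim (\<lambda>N::nat. \<Prod>p | prime p \<and> p \<le> N. pair_local_factor k M p)"

definition pair_count :: "nat \<Rightarrow> nat \<Rightarrow> nat \<Rightarrow> real \<Rightarrow> nat" where
  "pair_count k M a y = card {n::nat. n > 0 \<and> real n \<le> y \<and> prime (M * n + a) \<and> prime (M * n + a + k)}"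

lemma prod_progression_pair:
  assumes "k > 0"
  shows "(\<Prod>f\<in>progression_pair k M a. f) = [:int a, int M:] * [:int (a + k), int M:]"
  using assms by (simp add: progression_pair_def)

lemma poly_prod_progression_pair:
  assumes "k > 0"
  shows "poly (\<Prod>f\<in>progression_pair k M a. f) n = (int M * n + int a) * (int M * n + int a + int k)"
  unfolding prod_progression_pair[OF assms] by (simp add: algebra_simps)

text \<open>
  If \<open>p dvd M\<close>, both forms are constant and nonzero modulo \<open>p\<close>. Otherwise \<open>M\<close> is invertible modulo \<open>p\<close>,
  each form has one root, and the two roots coincide exactly when \<open>p dvd k\<close>.
\<close>

lemma num_roots_mod_progression_pair:
  assumes "k > 0" "prime p" "coprime a M" "coprime (a + k) M"
  shows "num_roots_mod (\<Prod>f\<in>progression_pair k M a. f) p = (if p dvd M then 0 else if p dvd k then 1 else 2)"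
proof -
  let ?R = "\<lambda>b. {n \<in> {0..<int p}. int p dvd int M * n + int b}"
  have pp: "prime (int p)" using assms by simp
  have p0: "int p > 0" using assms prime_gt_0_nat by simp
  have roots: "{n \<in> {0..<int p}. [poly (\<Prod>f\<in>progression_pair k M a. f) n = 0] (mod int p)} = ?R a \<union> ?R (a + k)"
    using pp by (auto simp: poly_prod_progression_pair[OF assms(1)] cong_0_iff prime_dvd_mult_iff add.assoc)
  show ?thesis
  proof (cases "p dvd M")
    case True
    have "?R b = {}" if "coprime b M" for b
    proof -
      have "\<not> int p dvd int M * n + int b" for n
      proof
        assume "int p dvd int M * n + int b"
        hence "int p dvd int b" using True by (simp add: dvd_add_right_iff)
        hence "p dvd b" by simp
        thus False using True that assms(2) by (meson coprime_common_divisor_nat not_prime_1 coprime_common_divisor not_prime_unit)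
      qed
      thus ?thesis by blast
    qed
    hence e: "?R a = {}" "?R (a + k) = {}" using assms(3,4) by blast+
    show ?thesis unfolding num_roots_mod_def roots e using True by simp
  next
    case False
    hence "coprime (int M) (int p)" using assms(2) prime_imp_coprime[of p M] by (simp add: coprime_commute)
    then obtain x where x: "[int M * x = 1] (mod int p)" using cong_solve_coprime_int by blast
    define r where "r = (\<lambda>b. (- x * int b) mod int p)"
    have R: "?R b = {r b}" for b
    proof -
      have "[int M * n + int b = 0] (mod int p) \<longleftrightarrow> [n = - x * int b] (mod int p)" for n
      proof
        assume "[int M * n + int b = 0] (mod int p)"
        hence "[x * (int M * n + int b) = x * 0] (mod int p)" by (rule cong_scalar_left)
        hence 1: "[(int M * x) * n + x * int b = 0] (mod int p)" by (simp add: algebra_simps)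
        have "[(int M * x) * n + x * int b = 1 * n + x * int b] (mod int p)"
          by (intro cong_add cong_mult x cong_refl)
        hence "[n + x * int b = 0] (mod int p)" using 1 by (metis cong_sym cong_trans mult_1)
        hence "[n + x * int b + (- x * int b) = 0 + (- x * int b)] (mod int p)" by (intro cong_add cong_refl)
        thus "[n = - x * int b] (mod int p)" by simp
      next
        assume "[n = - x * int b] (mod int p)"
        hence "[int M * n + int b = int M * (- x * int b) + int b] (mod int p)"
          by (intro cong_add cong_mult cong_refl)
        also have "int M * (- x * int b) + int b = - ((int M * x) * int b) + int b" by simp
        also have "[\<dots> = - (1 * int b) + int b] (mod int p)"
        proof (intro cong_add cong_refl)
          have "[(int M * x) * int b = 1 * int b] (mod int p)" using x by (rule cong_scalar_right)
          thus "[- ((int M * x) * int b) = - (1 * int b)] (mod int p)" by (simp only: cong_minus_minus_iff)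
        qed
        finally show "[int M * n + int b = 0] (mod int p)" by simp
      qed
      hence "?R b = {n \<in> {0..<int p}. n mod int p = r b}"
        by (auto simp: cong_0_iff cong_def r_def dvd_eq_mod_eq_0)
      also have "\<dots> = {r b}" using p0 by (auto simp: r_def)
      finally show ?thesis .
    qed
    have "r a = r (a + k) \<longleftrightarrow> p dvd k"
    proof -
      have "r a = r (a + k) \<longleftrightarrow> [- x * int a = - x * int (a + k)] (mod int p)"
        by (simp add: r_def cong_def)
      also have "\<dots> \<longleftrightarrow> int p dvd x * int k"
        by (simp add: cong_iff_dvd_diff algebra_simps)
      also have "\<dots> \<longleftrightarrow> int p dvd int k"
      proof -
        have "\<not> int p dvd x"
        proof
          assume "int p dvd x"
          hence "int p dvd int M * x" by simp
          hence "int p dvd 1" using x cong_dvd_iff by blast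
          thus False using pp not_prime_unit by blast
        qed
        thus ?thesis using pp by (simp add: prime_dvd_mult_iff)
      qed
      finally show ?thesis by simp
    qed
    thus ?thesis unfolding num_roots_mod_def roots R using False by (auto simp: card_insert_if)
  qed
qed

lemma card_progression_pair: "k > 0 \<Longrightarrow> card (progression_pair k M a) = 2"
  by (simp add: progression_pair_def)

lemma bateman_horn_constant_progression_pair:
  assumes "k > 0" "coprime a M" "coprime (a + k) M"
  shows "bateman_horn_constant (progression_pair k M a) = pair_constant k M"
  unfolding bateman_horn_constant_def pair_constant_def
  using assms
  by (intro arg_cong[of _ _ lim] ext prod.cong refl)
     (simp add: num_roots_mod_progression_pair card_progression_pair pair_local_factor_def)

text \<open>
  A fixed prime divisor \<open>p\<close> would have \<open>p\<close> roots; as there are at most two, \<open>p = 2\<close>, but \<open>k\<close> is even and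
  so there is at most one root modulo 2.
\<close>

lemma admissible_progression_pair:
  assumes "k > 0" "even k" "odd M" "coprime a M" "coprime (a + k) M"
  shows "admissible (progression_pair k M a)"
  unfolding admissible_def
proof (intro conjI ballI allI impI)
  have M: "M > 0" using assms by (auto intro: Nat.gr0I)
  fix f assume f: "f \<in> progression_pair k M a"
  hence "f = [:int a, int M:] \<or> f = [:int (a + k), int M:]"
    unfolding progression_pair_def by blast
  then obtain b where b: "f = [:int b, int M:]" "coprime b M" using assms(4,5) by blast
  show "lead_coeff f > 0" using b M by simp
  show "irreducible f" unfolding b using b M by (intro irreducible_linear_poly) auto
next
  fix p :: nat assume p: "prime p"
  show "\<not> (\<forall>n. [poly (\<Prod>f\<in>progression_pair k M a. f) n = 0] (mod int p))"
  proof
    assume "\<forall>n. [poly (\<Prod>f\<in>progression_pair k M a. f) n = 0] (mod int p)"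
    hence "num_roots_mod (\<Prod>f\<in>progression_pair k M a. f) p = card {0..<int p}"
      unfolding num_roots_mod_def by (intro arg_cong[of _ _ card]) auto
    hence eq: "p = (if p dvd M then 0 else if p dvd k then 1 else 2)"
      using num_roots_mod_progression_pair[OF assms(1) p assms(4,5)] by simp
    have "p > 1" using p prime_gt_1_nat by blast
    hence "\<not> p dvd k" "p = 2" using eq by (auto split: if_splits)
    thus False using assms(2) by simp
  qed
qed (auto simp: progression_pair_def)

lemma prime_value_count_progression_pair:
  "prime_value_count (progression_pair k M a) y = pair_count k M a y"
proof -
  have "(\<forall>f\<in>progression_pair k M a. prime (poly f (int n))) \<longleftrightarrow> prime (M * n + a) \<and> prime (M * n + a + k)" for n
  proof -
    have p: "poly [:int a, int M:] (int n) = int (M * n + a)"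
      "poly [:int (a + k), int M:] (int n) = int (M * n + a + k)" by (simp_all add: algebra_simps)
    have "(\<forall>f\<in>progression_pair k M a. prime (poly f (int n))) \<longleftrightarrow>
        prime (poly [:int a, int M:] (int n)) \<and> prime (poly [:int (a + k), int M:] (int n))"
      unfolding progression_pair_def by blast
    thus ?thesis unfolding p prime_nat_int_transfer .
  qed
  thus ?thesis unfolding prime_value_count_def pair_count_def by simp
qed

lemma pair_count_asymp:
  assumes "bateman_horn_conjecture" "k > 0" "even k" "odd M" "coprime a M" "coprime (a + k) M"
  shows "(\<lambda>y. real (pair_count k M a y)) \<sim>[at_top]
           (\<lambda>y. pair_constant k M * integral {2..y} (\<lambda>t. 1 / ln t ^ 2))"
proof -
  have M: "M > 0" using assms by (auto intro: Nat.gr0I)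
  let ?F = "progression_pair k M a"
  have deg: "real (\<Prod>f\<in>?F. degree f) = 1"
    using assms(2) M by (simp add: progression_pair_def)
  have "(\<lambda>x. real (prime_value_count ?F x)) \<sim>[at_top]
        (\<lambda>x. bateman_horn_constant ?F / real (\<Prod>f\<in>?F. degree f) * integral {2..x} (\<lambda>t. 1 / ln t ^ card ?F))"
    using assms(1) admissible_progression_pair[OF assms(2-6)]
    unfolding bateman_horn_conjecture_def by blast
  thus ?thesis
    unfolding prime_value_count_progression_pair card_progression_pair[OF assms(2)] deg
      bateman_horn_constant_progression_pair[OF assms(2,5,6)] by simp
qed

lemma prod_one_minus_inverse_square_ge:
  fixes P :: "nat set"
  assumes "finite P" "\<And>p. p \<in> P \<Longrightarrow> p \<ge> 3"
  shows "(\<Prod>p\<in>P. 1 - 1 / (real p - 1)\<^sup>2) \<ge> 1 / 2"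
proof -
  have tele: "(\<Prod>p\<in>{3..<N+3}. 1 - 1 / (real p - 1)\<^sup>2) = (real N + 2) / (2 * (real N + 1))" for N
  proof (induction N)
    case (Suc N)
    have "{3..<Suc N + 3} = insert (N + 3) {3..<N + 3}" by auto
    hence "(\<Prod>p\<in>{3..<Suc N+3}. 1 - 1 / (real p - 1)\<^sup>2) =
        (1 - 1 / (real N + 2)\<^sup>2) * ((real N + 2) / (2 * (real N + 1)))"
      using Suc by simp
    also have "\<dots> = (real (Suc N) + 2) / (2 * (real (Suc N) + 1))"
      by (simp add: divide_simps) (simp add: algebra_simps power2_eq_square)
    finally show ?case .
  qed auto
  obtain N where N: "P \<subseteq> {..<N}" using assms(1) finite_nat_iff_bounded by blast
  have sub: "P \<subseteq> {3..<N+3}" using N assms(2) by force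
  have g01: "0 \<le> 1 - 1 / (real p - 1)\<^sup>2 \<and> 1 - 1 / (real p - 1)\<^sup>2 \<le> 1" if "p \<ge> 3" for p :: nat
    using that one_le_power[of "real p - 1" 2] by simp
  have "1 / 2 \<le> (real N + 2) / (2 * (real N + 1))" by (simp add: field_simps)
  also have "\<dots> = (\<Prod>p\<in>{3..<N+3}. 1 - 1 / (real p - 1)\<^sup>2)" by (rule tele[symmetric])
  also have "\<dots> = (\<Prod>p\<in>P. 1 - 1 / (real p - 1)\<^sup>2) * (\<Prod>p\<in>{3..<N+3} - P. 1 - 1 / (real p - 1)\<^sup>2)"
    using sub by (subst prod.subset_diff[OF sub]) auto
  also have "\<dots> \<le> (\<Prod>p\<in>P. 1 - 1 / (real p - 1)\<^sup>2) * 1"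
  proof (intro mult_left_mono prod_le_1 prod_nonneg)
    fix p assume "p \<in> {3..<N+3} - P"
    thus "0 \<le> 1 - 1 / (real p - 1)\<^sup>2 \<and> 1 - 1 / (real p - 1)\<^sup>2 \<le> 1" by (intro g01) auto
  next
    fix p assume "p \<in> P"
    thus "0 \<le> 1 - 1 / (real p - 1)\<^sup>2" using g01 assms(2) by blast
  qed
  finally show ?thesis by simp
qed

text \<open>
  Beyond \<open>M\<close> and \<open>k\<close> the local factor at \<open>p\<close> equals \<open>1 - 1 / (p - 1)\<^sup>2\<close>. So the partial products
  are eventually decreasing and, by comparison with the telescoping product over all integers, bounded
  below by a positive constant.
\<close>

lemma pair_constant_pos:
  assumes "k > 0" "even k" "odd M"
  shows "pair_constant k M > 0"
proof -
  let ?g = "pair_local_factor k M"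
  let ?P = "\<lambda>N. {p. prime p \<and> p \<le> (N::nat)}"
  have fin: "finite (?P N)" for N by (rule finite_subset[of _ "{..N}"]) auto
  have M: "M > 0" using assms by (auto intro: Nat.gr0I)
  have gpos: "?g p > 0" if "prime p" for p
  proof -
    have p: "real p > 1" using prime_gt_1_nat[OF that] by simp
    have "(if p dvd M then 0 else if p dvd k then 1 else 2) / real p < 1"
    proof (cases "p = 2")
      case True
      thus ?thesis using assms by simp
    next
      case False
      hence "p > 2" using prime_ge_2_nat[OF that] by simp
      thus ?thesis by simp
    qed
    moreover have "(1 - 1 / real p)\<^sup>2 > 0" using p by simp
    ultimately show ?thesis unfolding pair_local_factor_def by (intro divide_pos_pos) simp_all
  qed
  define K where "K = M + k + 2"
  have g_eq: "?g p = 1 - 1 / (real p - 1)\<^sup>2" if "prime p" "p > K" for p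
  proof -
    have "\<not> p dvd M" "\<not> p dvd k" using that M assms by (auto simp: K_def dest!: dvd_imp_le)
    hence "?g p = (1 - 2 / real p) / (1 - 1 / real p)\<^sup>2" by (simp add: pair_local_factor_def)
    also have "\<dots> = 1 - 1 / (real p - 1)\<^sup>2"
      using that by (simp add: K_def divide_simps) (simp add: algebra_simps power2_eq_square)
    finally show ?thesis .
  qed
  define c where "c = (\<Prod>p\<in>?P K. ?g p)"
  have c: "c > 0" unfolding c_def using gpos by (intro prod_pos) auto
  define s where "s = (\<lambda>N. \<Prod>p\<in>?P (N + K). ?g p)"
  have split: "s N = c * (\<Prod>p\<in>?P (N + K) - ?P K. 1 - 1 / (real p - 1)\<^sup>2)" for N
  proof -
    have "s N = (\<Prod>p\<in>?P (N + K) - ?P K. ?g p) * c"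
      unfolding s_def c_def by (rule prod.subset_diff) (use fin in auto)
    also have "(\<Prod>p\<in>?P (N + K) - ?P K. ?g p) = (\<Prod>p\<in>?P (N + K) - ?P K. 1 - 1 / (real p - 1)\<^sup>2)"
      by (intro prod.cong refl g_eq) auto
    finally show ?thesis by (simp add: mult.commute)
  qed
  have lower: "s N \<ge> c / 2" for N
  proof -
    have "1 / 2 \<le> (\<Prod>p\<in>?P (N + K) - ?P K. 1 - 1 / (real p - 1)\<^sup>2)"
      using fin by (intro prod_one_minus_inverse_square_ge) (auto simp: K_def)
    hence "c * (1 / 2) \<le> s N" unfolding split using c by (intro mult_left_mono) auto
    thus ?thesis by simp
  qed
  have "decseq s"
  proof (rule decseq_SucI)
    fix N
    show "s (Suc N) \<le> s N"
    proof (cases "prime (Suc N + K)")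
      case True
      have "?P (Suc N + K) = insert (Suc N + K) (?P (N + K))" using True by (auto simp: le_Suc_eq)
      hence "s (Suc N) = ?g (Suc N + K) * s N" unfolding s_def using fin by simp
      also have "\<dots> \<le> 1 * s N"
        using g_eq[OF True] lower[of N] c by (intro mult_right_mono) auto
      finally show ?thesis by simp
    next
      case False
      hence "?P (Suc N + K) = ?P (N + K)" by (auto simp: le_Suc_eq)
      thus ?thesis by (simp add: s_def)
    qed
  qed
  then obtain L where L: "s \<longlonglongrightarrow> L" "L \<ge> c / 2"
    using decseq_convergent[of s "c / 2"] lower LIMSEQ_le_const by metis
  have "(\<lambda>N. \<Prod>p\<in>?P N. ?g p) \<longlonglongrightarrow> L"
    using L(1) unfolding s_def by (rule LIMSEQ_offset)
  hence "pair_constant k M = L" unfolding pair_constant_def by (rule limI)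
  thus ?thesis using L c by simp
qed

lemma integral_inverse_ln_square_ge:
  fixes x :: real
  assumes "x \<ge> 2"
  shows "integral {2..x} (\<lambda>t. 1 / ln t ^ 2) \<ge> (x - 2) / ln x ^ 2"
proof -
  have "integral {2..x} (\<lambda>t. 1 / ln x ^ 2) \<le> integral {2..x} (\<lambda>t. 1 / ln t ^ 2)"
  proof (rule integral_le)
    show "(\<lambda>t. 1 / ln t ^ 2) integrable_on {2..x}"
      by (intro integrable_continuous_real continuous_intros) auto
    fix t assume t: "t \<in> {2..x}"
    hence "0 < ln t" "ln t \<le> ln x" by auto
    thus "1 / ln x ^ 2 \<le> 1 / ln t ^ 2" by (intro divide_left_mono power_mono mult_pos_pos) auto
  qed auto
  thus ?thesis using assms by simp
qed

section \<open>Small prime divisors of \<open>p - 1\<close> and \<open>p + k - 1\<close>\<close>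

lemma finite_pair_count_set:
  "finite {n::nat. n > 0 \<and> real n \<le> y \<and> prime (M * n + a) \<and> prime (M * n + a + k)}"
  by (rule finite_subset[of _ "{..nat \<lfloor>y\<rfloor>}"]) (auto simp: le_nat_floor)

lemma finite_prime_pairs_upto: "finite (prime_pairs_upto k x)"
  by (rule finite_subset[of _ "{..nat \<lfloor>x\<rfloor>}"]) (auto simp: prime_pairs_upto_def le_nat_floor)

text \<open>
  The half-open interval from \<open>y - 1\<close> to \<open>y\<close> contains only one integer. The shift by 1 makes \<open>M * n + a \<le> x\<close> follow from
  \<open>n \<le> x / M - 1\<close> for every residue \<open>a < M\<close>.
\<close>

lemma pair_count_pred_ge: "pair_count k M a y \<le> pair_count k M a (y - 1) + 1"
proof -
  let ?S = "\<lambda>y. {n::nat. n > 0 \<and> real n \<le> y \<and> prime (M * n + a) \<and> prime (M * n + a + k)}"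
  have "?S y \<subseteq> insert (nat \<lfloor>y\<rfloor>) (?S (y - 1))"
  proof
    fix n assume n: "n \<in> ?S y"
    have "n = nat \<lfloor>y\<rfloor> \<or> real n \<le> y - 1" using n by simp linarith
    thus "n \<in> insert (nat \<lfloor>y\<rfloor>) (?S (y - 1))" using n by auto
  qed
  hence "card (?S y) \<le> card (insert (nat \<lfloor>y\<rfloor>) (?S (y - 1)))"
    by (rule card_mono[rotated]) (simp add: finite_pair_count_set)
  also have "\<dots> \<le> card (?S (y - 1)) + 1" by (simp add: card_insert_if finite_pair_count_set)
  finally show ?thesis unfolding pair_count_def .
qed

lemma card_residue_class_pairs_le:
  fixes k M :: nat and R :: "nat set" and x :: real
  assumes M: "M > 0" and T: "T \<subseteq> prime_pairs_upto k x"
    and R: "finite R" "\<And>p. p \<in> T \<Longrightarrow> p > M \<Longrightarrow> p mod M \<in> R"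
  shows "card T \<le> M + 1 + (\<Sum>a\<in>R. pair_count k M a (x / real M))"
proof -
  let ?S = "\<lambda>a. {n::nat. n > 0 \<and> real n \<le> x / real M \<and> prime (M * n + a) \<and> prime (M * n + a + k)}"
  have "T \<subseteq> {..M} \<union> (\<Union>a\<in>R. (\<lambda>n. M * n + a) ` ?S a)"
  proof
    fix p assume p: "p \<in> T"
    show "p \<in> {..M} \<union> (\<Union>a\<in>R. (\<lambda>n. M * n + a) ` ?S a)"
    proof (cases "p \<le> M")
      case False
      hence "p mod M \<in> R" using R(2) p by simp
      have p': "p = M * (p div M) + p mod M" by simp
      have pp: "prime p" "prime (p + k)" "real p \<le> x"
        using p T by (auto simp: prime_pairs_upto_def prime_pairs_def)
      have "real M * real (p div M) \<le> real p" by (metis of_nat_le_iff of_nat_mult times_div_less_eq_dividend)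
      hence "real (p div M) \<le> x / real M" using pp M by (simp add: field_simps)
      moreover have "p div M > 0" using False M by (simp add: div_greater_zero_iff)
      ultimately have "p div M \<in> ?S (p mod M)" using pp p' by simp
      hence "p \<in> (\<lambda>n. M * n + p mod M) ` ?S (p mod M)" using p' by blast
      thus ?thesis using \<open>p mod M \<in> R\<close> by blast
    qed auto
  qed
  hence "card T \<le> card ({..M} \<union> (\<Union>a\<in>R. (\<lambda>n. M * n + a) ` ?S a))"
    using R by (intro card_mono) (auto simp: finite_pair_count_set)
  also have "\<dots> \<le> card {..M} + card (\<Union>a\<in>R. (\<lambda>n. M * n + a) ` ?S a)" by (rule card_Un_le)
  also have "card (\<Union>a\<in>R. (\<lambda>n. M * n + a) ` ?S a) \<le> (\<Sum>a\<in>R. card ((\<lambda>n. M * n + a) ` ?S a))"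
    by (rule card_UN_le[OF R(1)])
  also have "\<dots> \<le> (\<Sum>a\<in>R. pair_count k M a (x / real M))"
    unfolding pair_count_def by (intro sum_mono card_image_le finite_pair_count_set)
  finally show ?thesis by simp
qed

lemma prime_pairs_count_ge_sum_residues:
  fixes k M :: nat and R :: "nat set" and x :: real
  assumes M: "M > 0" and R: "R \<subseteq> {..<M}"
  shows "(\<Sum>a\<in>R. pair_count k M a (x / real M - 1)) \<le> prime_pairs_count k x"
proof -
  let ?S = "\<lambda>a. {n::nat. n > 0 \<and> real n \<le> x / real M - 1 \<and> prime (M * n + a) \<and> prime (M * n + a + k)}"
  have finR: "finite R" using R finite_subset by blast
  have "(\<Sum>a\<in>R. pair_count k M a (x / real M - 1)) = (\<Sum>a\<in>R. card ((\<lambda>n. M * n + a) ` ?S a))"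
    unfolding pair_count_def using M by (intro sum.cong refl card_image[symmetric]) (auto simp: inj_on_def)
  also have "\<dots> = card (\<Union>a\<in>R. (\<lambda>n. M * n + a) ` ?S a)"
  proof (rule card_UN_disjoint[symmetric, OF finR])
    show "\<forall>a\<in>R. finite ((\<lambda>n. M * n + a) ` ?S a)" by (simp add: finite_pair_count_set)
    have "a = b" if "a \<in> R" "b \<in> R" "M * n + a = M * m + b" for a b n m
    proof -
      have "a < M" "b < M" using R that by auto
      hence "(M * n + a) mod M = a" "(M * m + b) mod M = b" by simp_all
      thus ?thesis using that(3) by metis
    qed
    thus "\<forall>a\<in>R. \<forall>b\<in>R. a \<noteq> b \<longrightarrow> (\<lambda>n. M * n + a) ` ?S a \<inter> (\<lambda>n. M * n + b) ` ?S b = {}" by blast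
  qed
  also have "\<dots> \<le> card (prime_pairs_upto k x)"
  proof (rule card_mono[OF finite_prime_pairs_upto])
    show "(\<Union>a\<in>R. (\<lambda>n. M * n + a) ` ?S a) \<subseteq> prime_pairs_upto k x"
    proof clarify
      fix a n assume a: "a \<in> R" and n: "real n \<le> x / real M - 1" "prime (M * n + a)" "prime (M * n + a + k)"
      have "real M * real n + real M \<le> x" using n(1) M by (simp add: field_simps)
      moreover have "real a \<le> real M" using R a by auto
      ultimately have "real (M * n + a) \<le> x" by simp
      thus "M * n + a \<in> prime_pairs_upto k x"
        using n by (simp add: prime_pairs_upto_def prime_pairs_def)
    qed
  qed
  finally show ?thesis by (simp add: prime_pairs_count_def)
qed

text \<open>
  Take \<open>M\<close> to be the product of a finite set \<open>B\<close> of primes with small Euler product. The admissible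
  residue classes modulo \<open>M\<close> all have the same Bateman--Horn asymptotics, so each contains a comparable
  number of the \<open>p\<close> in question, and by the Chinese remainder theorem the classes in which no \<open>l \<in> B\<close>
  divides \<open>p + h - 1\<close> are a proportion of at most \<open>\<Prod>l\<in>B. 1 - 1 / l\<close> of them. The set \<open>B\<close>
  and with it \<open>M\<close> depend on \<open>\<epsilon>\<close> but not on \<open>x\<close>, so the conjecture applies to each of the finitely many
  classes separately. Comparing the counts up to factors of 2 is enough.
\<close>

lemma prime_pairs_rarely_avoid_divisors:
  fixes k h y\<^sub>0 :: nat and \<epsilon> :: real
  assumes bh: "bateman_horn_conjecture" and k: "k > 0" "even k" and h: "h = 0 \<or> h = k" and \<epsilon>: "\<epsilon> > 0"
  obtains B where "finite B" "\<And>l. l \<in> B \<Longrightarrow> prime l \<and> l > y\<^sub>0"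
    "eventually (\<lambda>x. real (card {p \<in> prime_pairs_upto k x. \<forall>l\<in>B. \<not> l dvd p + h - 1})
       \<le> \<epsilon> * real (prime_pairs_count k x)) at_top"
proof -
  \<comment> \<open>The exceptional count turns out to be at most \<open>3 * \<delta>\<close>, and the total at least \<open>1 / 4\<close>, times the
    number of admissible classes times the common size \<open>G (x / M)\<close>.\<close>
  define \<delta> where "\<delta> = \<epsilon> / 12"
  have \<delta>: "\<delta> > 0" using \<epsilon> by (simp add: \<delta>_def)
  obtain B where B: "finite B" "\<And>p. p \<in> B \<Longrightarrow> prime p \<and> p > max y\<^sub>0 (k + 1)" "(\<Prod>p\<in>B. 1 - 1 / real p) < \<delta>"
    using exists_primes_with_small_Euler_product[OF \<delta>, of "max y\<^sub>0 (k + 1)"] by blast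
  have k2: "k \<ge> 2" using k by (elim evenE) auto
  define M where "M = \<Prod>B"
  have M: "M > 0" unfolding M_def using B by (intro prod_pos) (auto simp: prime_gt_0_nat)
  have oddM: "odd M"
  proof
    assume "even M"
    then obtain l where "l \<in> B" "even l" using B(1) by (auto simp: M_def even_prod_iff)
    hence "l = 2" using B(2) primes_dvd_imp_eq two_is_prime_nat by blast
    thus False using B(2)[OF \<open>l \<in> B\<close>] k2 by simp
  qed
  let ?A = "\<lambda>S. {a. a < M \<and> (\<forall>l\<in>B. a mod l \<in> S l)}"
  define S' where "S' = (\<lambda>l. {r \<in> pair_residues k l. \<not> [r + h = 1] (mod l)})"
  define Adm where "Adm = ?A (pair_residues k)"
  define R where "R = ?A S'"
  have finA: "finite Adm" "finite R" by (auto simp: Adm_def R_def)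
  have cA: "card Adm = (\<Prod>l\<in>B. card (pair_residues k l))" unfolding Adm_def M_def
    using B by (intro card_residues_prod) (auto simp: pair_residues_def)
  have cR: "card R = (\<Prod>l\<in>B. card (S' l))" unfolding R_def M_def
    using B by (intro card_residues_prod) (auto simp: pair_residues_def S'_def)
  have "\<forall>l\<in>B. card (pair_residues k l) > 0"
    using B h k by (auto intro!: card_pair_residues_avoiding_le(2)[where h = h])
  hence Apos: "card Adm > 0" unfolding cA by (intro prod_pos) auto
  have "real (card R) \<le> (\<Prod>l\<in>B. (1 - 1 / real l) * real (card (pair_residues k l)))"
    unfolding cR of_nat_prod
  proof (intro prod_mono conjI)
    fix l assume "l \<in> B"
    thus "real (card (S' l)) \<le> (1 - 1 / real l) * real (card (pair_residues k l))"
      unfolding S'_def using B(2) h k by (intro card_pair_residues_avoiding_le(1)) auto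
  qed simp
  also have "\<dots> = (\<Prod>l\<in>B. 1 - 1 / real l) * real (card Adm)" by (simp add: cA prod.distrib)
  also have "\<dots> \<le> \<delta> * real (card Adm)" using B(3) by (intro mult_right_mono) auto
  finally have RA: "real (card R) \<le> \<delta> * real (card Adm)" .
  have RsubA: "R \<subseteq> Adm" by (auto simp: R_def Adm_def S'_def)
  have cop: "coprime a M \<and> coprime (a + k) M" if "a \<in> Adm" for a
  proof -
    have "coprime a l \<and> coprime (a + k) l" if "l \<in> B" for l
    proof -
      have "a mod l \<in> pair_residues k l" using that \<open>a \<in> Adm\<close> by (auto simp: Adm_def)
      hence "\<not> l dvd a" "\<not> l dvd a + k"
        by (auto simp: pair_residues_def dvd_eq_mod_eq_0 mod_add_left_eq)
      hence "coprime l a" "coprime l (a + k)" using B(2)[OF that] by (auto intro: prime_imp_coprime)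
      thus ?thesis using coprime_commute by blast
    qed
    thus ?thesis unfolding M_def by (auto intro!: prod_coprime_right)
  qed

  define G where "G = (\<lambda>y. pair_constant k M * integral {2..y} (\<lambda>t. 1 / ln t ^ 2))"
  have C: "pair_constant k M > 0" using k oddM by (rule pair_constant_pos)
  have G: "filterlim G at_top at_top"
  proof (rule filterlim_at_top_mono)
    have "filterlim (\<lambda>y::real. (y - 2) / ln y ^ 2) at_top at_top" by real_asymp
    thus "filterlim (\<lambda>y. pair_constant k M * ((y - 2) / ln y ^ 2)) at_top at_top"
      using C by (intro filterlim_tendsto_pos_mult_at_top[OF tendsto_const])
    show "eventually (\<lambda>y. pair_constant k M * ((y - 2) / ln y ^ 2) \<le> G y) at_top"
      using eventually_ge_at_top[of 2]
    proof eventually_elim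
      case (elim y)
      thus ?case using C unfolding G_def by (intro mult_left_mono integral_inverse_ln_square_ge) auto
    qed
  qed
  have "eventually (\<lambda>y. real (pair_count k M a y) \<le> 2 * G y \<and> G y / 2 \<le> real (pair_count k M a y)) at_top"
    if "a \<in> Adm" for a
  proof -
    have asy: "(\<lambda>y. real (pair_count k M a y)) \<sim>[at_top] G"
      unfolding G_def using cop[OF that] by (intro pair_count_asymp bh k oddM) auto
    have "eventually (\<lambda>y. G y \<ge> 0) at_top" using G unfolding filterlim_at_top by blast
    moreover have "eventually (\<lambda>y. norm (real (pair_count k M a y)) \<le> 2 * norm (G y)) at_top"
      by (rule asymp_equiv_imp_eventually_le[OF asy]) simp
    moreover have "eventually (\<lambda>y. norm (real (pair_count k M a y)) \<ge> 1 / 2 * norm (G y)) at_top"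
      by (rule asymp_equiv_imp_eventually_ge[OF asy]) simp
    ultimately show ?thesis by eventually_elim simp
  qed
  hence "eventually (\<lambda>y. \<forall>a\<in>Adm. real (pair_count k M a y) \<le> 2 * G y \<and> G y / 2 \<le> real (pair_count k M a y)) at_top"
    using finA by (intro eventually_ball_finite) auto
  moreover have "eventually (\<lambda>y. G y \<ge> max 4 ((real M + 1) / \<delta>)) at_top"
    using G unfolding filterlim_at_top by blast
  ultimately have "eventually (\<lambda>y. (\<forall>a\<in>Adm. real (pair_count k M a y) \<le> 2 * G y \<and> G y / 2 \<le> real (pair_count k M a y)) \<and>
      G y \<ge> max 4 ((real M + 1) / \<delta>)) at_top" by (rule eventually_conj)
  moreover have "filterlim (\<lambda>x::real. x / real M) at_top at_top"
  proof -
    have "filterlim (\<lambda>x::real. 1 / real M * x) at_top at_top"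
      using M by (intro filterlim_tendsto_pos_mult_at_top[OF tendsto_const] filterlim_ident) simp
    thus ?thesis by simp
  qed
  ultimately have "eventually (\<lambda>x. (\<forall>a\<in>Adm. real (pair_count k M a (x / real M)) \<le> 2 * G (x / real M) \<and>
       G (x / real M) / 2 \<le> real (pair_count k M a (x / real M))) \<and>
      G (x / real M) \<ge> max 4 ((real M + 1) / \<delta>)) at_top"
    by (rule eventually_compose_filterlim)
  hence ev: "eventually (\<lambda>x. real (card {p \<in> prime_pairs_upto k x. \<forall>l\<in>B. \<not> l dvd p + h - 1})
       \<le> \<epsilon> * real (prime_pairs_count k x)) at_top"
  proof eventually_elim
    case (elim x)
    define g where "g = G (x / real M)"
    have pc: "real (pair_count k M a (x / real M)) \<le> 2 * g" "g / 2 \<le> real (pair_count k M a (x / real M))"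
      if "a \<in> Adm" for a using elim that by (auto simp: g_def)
    have g: "g \<ge> 4" "g \<ge> (real M + 1) / \<delta>" using elim by (auto simp: g_def)
    define T where "T = {p \<in> prime_pairs_upto k x. \<forall>l\<in>B. \<not> l dvd p + h - 1}"
    have "card T \<le> M + 1 + (\<Sum>a\<in>R. pair_count k M a (x / real M))"
    proof (rule card_residue_class_pairs_le[OF M _ finA(2)])
      show "T \<subseteq> prime_pairs_upto k x" by (auto simp: T_def)
      fix p assume p: "p \<in> T" "p > M"
      have pp: "prime p" "prime (p + k)" using p by (auto simp: T_def prime_pairs_upto_def prime_pairs_def)
      have "(p mod M) mod l \<in> S' l" if l: "l \<in> B" for l
      proof -
        have lM: "l dvd M" unfolding M_def using B l by (intro dvd_prodI) auto
        have lp: "l < p" using dvd_imp_le[OF lM M] p(2) by linarith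
        have l1: "prime l" using B l by auto
        have "\<not> l dvd p" "\<not> l dvd p + k"
          using primes_dvd_imp_eq[OF l1 pp(1)] primes_dvd_imp_eq[OF l1 pp(2)] lp by auto
        moreover have "\<not> [p + h = 1] (mod l)"
        proof
          assume "[p + h = 1] (mod l)"
          moreover have "1 \<le> p + h" using prime_ge_1_nat[OF pp(1)] by simp
          ultimately have "l dvd p + h - 1" using cong_altdef_nat by blast
          thus False using p l by (auto simp: T_def)
        qed
        moreover have "(p mod M) mod l = p mod l" using lM by (rule mod_mod_cancel)
        ultimately show ?thesis using prime_gt_0_nat[OF l1]
          by (auto simp: S'_def pair_residues_def dvd_eq_mod_eq_0 cong_def mod_simps)
      qed
      thus "p mod M \<in> R" using M by (auto simp: R_def)
    qed
    hence "real (card T) \<le> real M + 1 + (\<Sum>a\<in>R. real (pair_count k M a (x / real M)))"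
      by (metis of_nat_1 of_nat_add of_nat_le_iff of_nat_sum)
    also have "(\<Sum>a\<in>R. real (pair_count k M a (x / real M))) \<le> (\<Sum>a\<in>R. 2 * g)"
      using pc RsubA by (intro sum_mono) auto
    also have "\<dots> = real (card R) * (2 * g)" by simp
    also have "\<dots> \<le> \<delta> * real (card Adm) * (2 * g)" using RA g by (intro mult_right_mono) auto
    also have "real M + 1 \<le> \<delta> * g" using g \<delta> by (simp add: field_simps)
    also have "\<dots> \<le> \<delta> * g * real (card Adm)" using Apos g \<delta> by simp
    finally have up: "real (card T) \<le> 3 * \<delta> * real (card Adm) * g" by (simp add: algebra_simps)

    have "real (card Adm) * (g / 4) = (\<Sum>a\<in>Adm. g / 4)" by simp
    also have "\<dots> \<le> (\<Sum>a\<in>Adm. real (pair_count k M a (x / real M - 1)))"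
    proof (intro sum_mono)
      fix a assume a: "a \<in> Adm"
      have "real (pair_count k M a (x / real M)) \<le> real (pair_count k M a (x / real M - 1)) + 1"
        using pair_count_pred_ge[of k M a "x / real M"] by linarith
      thus "g / 4 \<le> real (pair_count k M a (x / real M - 1))" using pc(2)[OF a] g by linarith
    qed
    also have "\<dots> \<le> real (prime_pairs_count k x)"
      using prime_pairs_count_ge_sum_residues[OF M, of Adm k x]
      by (simp add: Adm_def subset_iff flip: of_nat_sum)
    finally have low: "real (card Adm) * (g / 4) \<le> real (prime_pairs_count k x)" .
    have "3 * \<delta> * real (card Adm) * g = \<epsilon> * (real (card Adm) * (g / 4))" by (simp add: \<delta>_def)
    also have "\<dots> \<le> \<epsilon> * real (prime_pairs_count k x)" using low \<epsilon> by (intro mult_left_mono) auto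
    finally show ?case using up unfolding T_def by linarith
  qed
  show ?thesis using B(1,2) ev by (intro that[of B]) auto
qed

text \<open>
  Induction on \<open>v\<close>: outside a set of small proportion, some prime of a finite set \<open>B\<close> divides
  \<open>p + h - 1\<close>; the further divisors are then sought among the primes beyond \<open>B\<close>.
\<close>

lemma prime_pairs_rarely_few_divisors:
  fixes k h v y\<^sub>0 :: nat and \<epsilon> :: real
  assumes "bateman_horn_conjecture" "k > 0" "even k" "h = 0 \<or> h = k" "\<epsilon> > 0"
  shows "eventually (\<lambda>x. real (card {p \<in> prime_pairs_upto k x. card {l. prime l \<and> l > y\<^sub>0 \<and> l dvd p + h - 1} < v})
       \<le> \<epsilon> * real (prime_pairs_count k x)) at_top"
  using \<open>\<epsilon> > 0\<close>
proof (induction v arbitrary: y\<^sub>0 \<epsilon>)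
  case 0
  thus ?case by simp
next
  case (Suc v)
  have "\<epsilon> / 2 > 0" using Suc.prems by simp
  obtain B where B: "finite B" "\<And>l. l \<in> B \<Longrightarrow> prime l \<and> l > y\<^sub>0"
    "eventually (\<lambda>x. real (card {p \<in> prime_pairs_upto k x. \<forall>l\<in>B. \<not> l dvd p + h - 1})
       \<le> \<epsilon> / 2 * real (prime_pairs_count k x)) at_top"
    using prime_pairs_rarely_avoid_divisors[OF assms(1-4) \<open>\<epsilon> / 2 > 0\<close>, where y\<^sub>0 = y\<^sub>0] by blast
  define y\<^sub>1 where "y\<^sub>1 = Max (insert y\<^sub>0 B)"
  have y1: "y\<^sub>0 \<le> y\<^sub>1" "\<And>l. l \<in> B \<Longrightarrow> l \<le> y\<^sub>1" using B(1) by (auto simp: y\<^sub>1_def)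
  have "eventually (\<lambda>x. real (card {p \<in> prime_pairs_upto k x. card {l. prime l \<and> l > y\<^sub>1 \<and> l dvd p + h - 1} < v})
       \<le> \<epsilon> / 2 * real (prime_pairs_count k x)) at_top"
    using Suc.prems by (intro Suc.IH) simp
  with B(3) show ?case
  proof eventually_elim
    case (elim x)
    let ?D = "\<lambda>y p. {l. prime l \<and> l > y \<and> l dvd p + h - 1}"
    let ?T1 = "{p \<in> prime_pairs_upto k x. \<forall>l\<in>B. \<not> l dvd p + h - 1}"
    let ?T2 = "{p \<in> prime_pairs_upto k x. card (?D y\<^sub>1 p) < v}"
    have "{p \<in> prime_pairs_upto k x. card (?D y\<^sub>0 p) < Suc v} \<subseteq> ?T1 \<union> ?T2"
    proof
      fix p assume p: "p \<in> {p \<in> prime_pairs_upto k x. card (?D y\<^sub>0 p) < Suc v}"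
      have "p > 1" using p prime_gt_1_nat[of p] by (auto simp: prime_pairs_upto_def prime_pairs_def)
      hence fin: "finite (?D y p)" for y by (rule_tac finite_subset[of _ "{l. l dvd p + h - 1}"]) auto
      show "p \<in> ?T1 \<union> ?T2"
      proof (cases "\<forall>l\<in>B. \<not> l dvd p + h - 1")
        case False
        then obtain l where l: "l \<in> B" "l dvd p + h - 1" by blast
        have "insert l (?D y\<^sub>1 p) \<subseteq> ?D y\<^sub>0 p" using l B(2) y1 by auto
        hence "card (insert l (?D y\<^sub>1 p)) \<le> card (?D y\<^sub>0 p)" by (intro card_mono fin)
        moreover have "l \<notin> ?D y\<^sub>1 p" using y1(2)[OF l(1)] by simp
        ultimately have "card (?D y\<^sub>1 p) + 1 \<le> card (?D y\<^sub>0 p)" using fin by simp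
        thus ?thesis using p by simp
      qed (use p in auto)
    qed
    hence "card {p \<in> prime_pairs_upto k x. card (?D y\<^sub>0 p) < Suc v} \<le> card (?T1 \<union> ?T2)"
      by (intro card_mono) (auto simp: finite_prime_pairs_upto)
    also have "\<dots> \<le> card ?T1 + card ?T2" by (rule card_Un_le)
    finally show ?case using elim by linarith
  qed
qed

text \<open>
  The case \<open>M = 1\<close>, \<open>a = 0\<close>. It shows that a set of size \<open>o(x / ln\<^sup>2 x)\<close> is negligible among the prime
  pairs.
\<close>

lemma bigo_prime_pairs_count:
  assumes "bateman_horn_conjecture" "k > 0" "even k"
  shows "(\<lambda>x. x / ln x ^ 2) \<in> O(\<lambda>x. real (prime_pairs_count k x))"
proof -
  have cnt: "pair_count k 1 0 x = prime_pairs_count k x" for x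
    unfolding pair_count_def prime_pairs_count_def prime_pairs_upto_def prime_pairs_def
    by (intro arg_cong[of _ _ card]) (auto simp: prime_gt_0_nat)
  have C: "pair_constant k 1 > 0" using assms by (intro pair_constant_pos) auto
  have asy: "(\<lambda>x. real (prime_pairs_count k x)) \<sim>[at_top]
      (\<lambda>y. pair_constant k 1 * integral {2..y} (\<lambda>t. 1 / ln t ^ 2))"
    using pair_count_asymp[OF assms, of 1 0] unfolding cnt by simp
  have "(\<lambda>x::real. x / ln x ^ 2) \<in> O(\<lambda>x. (x - 2) / ln x ^ 2)" by real_asymp
  also have "(\<lambda>x::real. (x - 2) / ln x ^ 2) \<in> O(\<lambda>y. pair_constant k 1 * integral {2..y} (\<lambda>t. 1 / ln t ^ 2))"
  proof (rule bigoI)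
    show "eventually (\<lambda>x::real. norm ((x - 2) / ln x ^ 2) \<le>
        1 / pair_constant k 1 * norm (pair_constant k 1 * integral {2..x} (\<lambda>t. 1 / ln t ^ 2))) at_top"
      using eventually_ge_at_top[of 2]
    proof eventually_elim
      case (elim x)
      have "norm ((x - 2) / ln x ^ 2) = (x - 2) / ln x ^ 2" using elim by simp
      also have "\<dots> \<le> norm (integral {2..x} (\<lambda>t. 1 / ln t ^ 2))"
        using integral_inverse_ln_square_ge[OF elim] by simp
      finally show ?case using C by (simp add: abs_mult)
    qed
  qed
  also have "(\<lambda>y. pair_constant k 1 * integral {2..y} (\<lambda>t. 1 / ln t ^ 2)) \<in> O(\<lambda>x. real (prime_pairs_count k x))"
    using asy by (intro asymp_equiv_imp_bigo) (simp add: asymp_equiv_sym)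
  finally show ?thesis .
qed

section \<open>The sign of the product\<close>

text \<open>
  With \<open>n = p - 1\<close>, \<open>a = totient n\<close>, \<open>b = totient (n + k)\<close>: if \<open>a > b\<close>, both factors are positive. If
  \<open>a < b\<close> and the product is not positive, then \<open>b / (n + k) \<le> a / n\<close>, hence
  \<open>b \<le> a + k * a / n \<le> a + k\<close>, which is impossible for two multiples of \<open>d > k\<close>.
\<close>

lemma sign_product_pos_or_equal_totients:
  fixes k p :: nat
  assumes p: "p > 1" "k > 0"
    and div: "d dvd totient (p - 1)" "d dvd totient (p + k - 1)" and d: "d > k"
    and neg: "\<not> totient_ratio_diff k p * totient_diff k p > 0"
  shows "totient (p - 1) = totient (p - 1 + k)"
proof -
  define n where "n = p - 1"
  have n: "n > 0" "p + k - 1 = n + k" using p by (auto simp: n_def)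
  define a where "a = totient n"
  define b where "b = totient (n + k)"
  have pos: "a > 0" "b > 0" "a \<le> n" using n by (auto simp: a_def b_def totient_le)
  have S: "totient_ratio_diff k p = real a / real n - real b / real (n + k)"
    and T: "totient_diff k p = real a - real b"
    unfolding totient_ratio_diff_def totient_diff_def a_def b_def n(2) n_def by (rule refl)+
  have "\<not> a > b"
  proof
    assume "a > b"
    have "real b / real (n + k) \<le> real b / real n" using n by (intro divide_left_mono) auto
    also have "\<dots> < real a / real n" using \<open>a > b\<close> n by (intro divide_strict_right_mono) auto
    finally have "totient_ratio_diff k p > 0" using S by simp
    moreover have "totient_diff k p > 0" using T \<open>a > b\<close> by simp
    ultimately show False using neg by simp
  qed
  moreover have "\<not> a < b"
  proof
    assume "a < b"
    hence Tneg: "totient_diff k p < 0" using T by simp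
    have "\<not> totient_ratio_diff k p < 0" using neg Tneg mult_neg_neg by blast
    hence "real b / real (n + k) \<le> real a / real n" using S by simp
    hence "real b * real n \<le> real a * real (n + k)" using n by (simp add: field_simps)
    hence "b * n \<le> a * (n + k)" by (metis of_nat_le_iff of_nat_mult)
    also have "\<dots> \<le> a * n + n * k" using pos by (simp add: distrib_left)
    finally have "b * n \<le> (a + k) * n" by (simp add: algebra_simps)
    hence "b \<le> a + k" using n by simp
    moreover have "d dvd a" using div(1) by (simp only: a_def n_def)
    moreover have "d dvd b" using div(2) by (simp only: b_def n(2))
    ultimately have "b \<le> a + k" "d dvd b - a" by (auto intro: dvd_diff_nat)
    moreover have "d \<le> b - a" using \<open>a < b\<close> \<open>d dvd b - a\<close> by (intro dvd_imp_le) auto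
    ultimately show False using d by simp
  qed
  ultimately show ?thesis by (simp add: a_def b_def n_def)
qed

theorem theorem6:
  fixes k :: nat
  assumes "bateman_horn_conjecture"
    and "k > 0" and "even k"
  shows "(\<lambda>x::real. real (card {p \<in> prime_pairs_upto k x. totient_ratio_diff k p * totient_diff k p > 0}))
           \<sim>[at_top] (\<lambda>x. real (prime_pairs_count k x))"
proof -
  define Good where "Good = (\<lambda>x. {p \<in> prime_pairs_upto k x. totient_ratio_diff k p * totient_diff k p > 0})"
  define Bad where "Bad = (\<lambda>x. {p \<in> prime_pairs_upto k x. \<not> totient_ratio_diff k p * totient_diff k p > 0})"
  define t where "t = (\<lambda>X. real (card {n \<in> {1..X}. totient n = totient (n + k) \<and> k + 2 \<le> card (prime_factors n)}))"
  define \<pi> where "\<pi> = (\<lambda>x. real (prime_pairs_count k x))"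
  define Few where "Few = (\<lambda>h x. {p \<in> prime_pairs_upto k x. card {l. prime l \<and> l > 0 \<and> l dvd p + h - 1} < k + 2})"
  have "(\<lambda>x::real. t (nat \<lfloor>x\<rfloor>)) \<in> o(\<lambda>x. real (nat \<lfloor>x\<rfloor>) / ln (real (nat \<lfloor>x\<rfloor>)) ^ 2)"
    unfolding t_def
    by (rule landau_o.small.compose[OF card_equal_totient_shift_smallo[OF assms(2)]])
       (rule filterlim_compose[OF filterlim_nat_sequentially filterlim_floor_sequentially])
  also have "(\<lambda>x::real. real (nat \<lfloor>x\<rfloor>) / ln (real (nat \<lfloor>x\<rfloor>)) ^ 2) \<in> O(\<lambda>x. x / ln x ^ 2)"
    by real_asymp
  also have "(\<lambda>x. x / ln x ^ 2) \<in> O(\<pi>)" unfolding \<pi>_def by (rule bigo_prime_pairs_count[OF assms])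
  finally have t_small: "(\<lambda>x::real. t (nat \<lfloor>x\<rfloor>)) \<in> o(\<pi>)" .
  have bad_le: "real (card (Bad x)) \<le> real (card (Few 0 x)) + real (card (Few k x)) + t (nat \<lfloor>x\<rfloor>)" for x
  proof -
    let ?T = "{n \<in> {1..nat \<lfloor>x\<rfloor>}. totient n = totient (n + k) \<and> k + 2 \<le> card (prime_factors n)}"
    have "Bad x \<subseteq> Few 0 x \<union> Few k x \<union> Suc ` ?T"
    proof (rule subsetI, rule ccontr)
      fix p assume p: "p \<in> Bad x" and np: "p \<notin> Few 0 x \<union> Few k x \<union> Suc ` ?T"
      have pp: "p \<in> prime_pairs_upto k x" "p > 1" "real p \<le> x" "\<not> totient_ratio_diff k p * totient_diff k p > 0"
        using p prime_gt_1_nat[of p] by (auto simp: Bad_def prime_pairs_upto_def prime_pairs_def)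
      have pf: "{l. prime l \<and> l > 0 \<and> l dvd m} = prime_factors m" if "m > 0" for m :: nat
        using that by (auto simp: in_prime_factors_iff prime_gt_0_nat)
      have om: "k + 2 \<le> card (prime_factors (p - 1))" "k + 2 \<le> card (prime_factors (p + k - 1))"
        using np pp pf[of "p - 1"] pf[of "p + k - 1"] by (auto simp: Few_def)
      have "totient (p - 1) = totient (p - 1 + k)"
      proof (rule sign_product_pos_or_equal_totients[where d = "2 ^ (k + 1)"])
        show "2 ^ (k + 1) dvd totient (p - 1)" "2 ^ (k + 1) dvd totient (p + k - 1)"
          by (intro two_power_dvd_totient; use om pp in simp)+
        show "k < 2 ^ (k + 1)" using less_exp[of "k + 1"] by simp
      qed (use pp assms in auto)
      moreover have "p - 1 \<in> {1..nat \<lfloor>x\<rfloor>}" using pp by (auto simp: le_nat_floor)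
      ultimately have "p - 1 \<in> ?T" using om by simp
      moreover have "p = Suc (p - 1)" using pp by simp
      ultimately show False using np by blast
    qed
    hence "card (Bad x) \<le> card (Few 0 x \<union> Few k x \<union> Suc ` ?T)"
      by (intro card_mono) (auto simp: Few_def finite_prime_pairs_upto)
    also have "\<dots> \<le> card (Few 0 x) + card (Few k x) + card (Suc ` ?T)"
      by (intro order_trans[OF card_Un_le] add_right_mono order_refl)
    also have "card (Suc ` ?T) \<le> card ?T" by (intro card_image_le) simp
    finally show ?thesis unfolding t_def by linarith
  qed
  have "(\<lambda>x. real (card (Bad x))) \<in> o(\<pi>)"
  proof (rule landau_o.smallI)
    fix c :: real assume "c > 0"
    hence c: "c / 3 > 0" by simp
    have "eventually (\<lambda>x. real (card (Few 0 x)) \<le> c / 3 * \<pi> x) at_top"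
      "eventually (\<lambda>x. real (card (Few k x)) \<le> c / 3 * \<pi> x) at_top"
      unfolding Few_def \<pi>_def using assms c by (intro prime_pairs_rarely_few_divisors; simp)+
    moreover have "eventually (\<lambda>x. norm (t (nat \<lfloor>x\<rfloor>)) \<le> c / 3 * norm (\<pi> x)) at_top"
      using landau_o.smallD[OF t_small c] .
    ultimately show "eventually (\<lambda>x. norm (real (card (Bad x))) \<le> c * norm (\<pi> x)) at_top"
    proof eventually_elim
      case (elim x)
      have "\<pi> x \<ge> 0" "t (nat \<lfloor>x\<rfloor>) \<ge> 0" by (simp_all add: \<pi>_def t_def)
      thus ?case using elim bad_le[of x] by simp
    qed
  qed
  moreover have "real (card (Good x)) - \<pi> x = - real (card (Bad x))" for x
  proof -
    have "card (prime_pairs_upto k x) = card (Good x) + card (Bad x)"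
      unfolding Good_def Bad_def using finite_prime_pairs_upto
      by (subst card_Un_disjoint[symmetric]) (auto intro: arg_cong[of _ _ card])
    thus ?thesis by (simp add: \<pi>_def prime_pairs_count_def)
  qed
  ultimately have "(\<lambda>x. real (card (Good x)) - \<pi> x) \<in> o(\<pi>)" by simp
  hence "(\<lambda>x. real (card (Good x))) \<sim>[at_top] \<pi>" by (rule smallo_imp_asymp_equiv)
  thus ?thesis unfolding Good_def \<pi>_def .
qed

end
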